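(* A constellation $[\mathbb{X},\mathbb{P}]$ (natural binary code labeling, bit probabilities $P_{C_k}(0)\in(0,1)$) is first-order optimal if and only if the Hadamard transform $\tilde{\mathbb{X}}$ of $\mathbb{X}$ satisfies both $$\tilde{\boldsymbol{x}}_0=\sum_{k=0}^{m-1}\tilde{\boldsymbol{x}}_{2^k}\big(P_{C_k}(1)-P_{C_k}(0)\big)$$ and $$\tilde{\boldsymbol{x}}_j=\boldsymbol{0}\quad\text{for all } j\notin\{0\}\cup\{1,2,4,\ldots,M/2\}.$$
   Context: Let $m\ge1$, $M=2^m$, $N\ge1$. For $0\le i\le M-1$, $n_{i,k}\in\{0,1\}$ is the $k$-th bit of $i$ ($i=\sum_kn_{i,k}2^k$). A constellation $[\mathbb{X},\mathbb{P}]$ consists of an alphabet $\mathbb{X}$ with rows $\boldsymbol{x}_0,\ldots,\boldsymbol{x}_{M-1}\in\mathbb{R}^N$, symbol $\boldsymbol{x}_i$ labeled $(n_{i,0},\ldots,n_{i,m-1})$, and distribution $P_i=\prod_kP_{C_k}(n_{i,k})$, $P_{C_k}(1)=1-P_{C_k}(0)$; i.e. independent bits $C_k$ with $\Pr(C_k=u)=P_{C_k}(u)$ select $\boldsymbol{X}=\boldsymbol{x}_i$, $i=\sum_kC_k2^k$. Hadamard transform: $\tilde{\boldsymbol{x}}_i=\frac1M\sum_j\boldsymbol{x}_jh_{i,j}$, $h_{i,j}=\prod_k(-1)^{n_{i,k}n_{j,k}}$. Channel: $\boldsymbol{Y}=\boldsymbol{H}\circ\boldsymbol{X}+\boldsymbol{Z}$,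 $\boldsymbol{Z}$ zero-mean Gaussian with variance $N_0/2$ per dimension, $\boldsymbol{H}$ real fading vector with common marginal pdf $p_H$, known at the receiver (standard regularity conditions assumed). $E_s=\mathbb{E}[\|\boldsymbol{X}\|^2]$, $\mathrm{SNR}=\mathbb{E}[H^2]E_s/N_0$. BICM-GMI: $I(\mathrm{SNR})=\sum_kI(C_k;\boldsymbol{Y}\mid\boldsymbol{H})$ in bits, as a function of SNR; $\alpha=\frac{dI}{d\,\mathrm{SNR}}\big|_{\mathrm{SNR}=0}$. The constellation is first-order optimal (FOO) if $\alpha=\log_2 e$ (i.e. BICM achieves the Shannon limit $-1.59$ dB). *)

theory Defs
  imports "HOL-Probability.Probability"
begin

definition bitv :: "nat \<Rightarrow> nat \<Rightarrow> nat" where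
  "bitv i k = i div 2 ^ k mod 2"

definition PC :: "(nat \<Rightarrow> real) \<Rightarrow> nat \<Rightarrow> nat \<Rightarrow> real" where
  "PC P0 k u = (if u = 0 then P0 k else 1 - P0 k)"

definition symprob :: "nat \<Rightarrow> (nat \<Rightarrow> real) \<Rightarrow> nat \<Rightarrow> real" where
  "symprob m P0 i = (\<Prod>k<m. PC P0 k (bitv i k))"

definition Esym :: "nat \<Rightarrow> (nat \<Rightarrow> real) \<Rightarrow> (nat \<Rightarrow> real ^ 'n) \<Rightarrow> real" where
  "Esym m P0 x = (\<Sum>i<2 ^ m. symprob m P0 i * (norm (x i))\<^sup>2)"

definition hadamard_transform :: "nat \<Rightarrow> (nat \<Rightarrow> real ^ 'n) \<Rightarrow> nat \<Rightarrow> real ^ 'n" where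
  "hadamard_transform m x i =
     (1 / real (2 ^ m)) *\<^sub>R (\<Sum>j<2 ^ m. (\<Prod>k<m. (-1::real) ^ (bitv i k * bitv j k)) *\<^sub>R x j)"

definition gauss_pdf :: "real \<Rightarrow> real ^ 'n \<Rightarrow> real" where
  "gauss_pdf s2 y = (2 * pi * s2) powr (- real CARD('n) / 2) * exp (- (norm y)\<^sup>2 / (2 * s2))"

definition fade :: "real ^ 'n \<Rightarrow> real ^ 'n \<Rightarrow> real ^ 'n" where
  "fade h v = (\<chi> j. h $ j * v $ j)"

definition out_pdf :: "nat \<Rightarrow> (nat \<Rightarrow> real) \<Rightarrow> (nat \<Rightarrow> real ^ 'n) \<Rightarrow> real \<Rightarrow> real ^ 'n \<Rightarrow> real ^ 'n \<Rightarrow> real" where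
  "out_pdf m P0 x s2 h y = (\<Sum>i<2 ^ m. symprob m P0 i * gauss_pdf s2 (y - fade h (x i)))"

definition bit_pdf :: "nat \<Rightarrow> (nat \<Rightarrow> real) \<Rightarrow> (nat \<Rightarrow> real ^ 'n) \<Rightarrow> real \<Rightarrow> real ^ 'n \<Rightarrow> nat \<Rightarrow> nat \<Rightarrow> real ^ 'n \<Rightarrow> real" where
  "bit_pdf m P0 x s2 h k u y =
     (\<Sum>i\<in>{i. i < 2 ^ m \<and> bitv i k = u}. symprob m P0 i / PC P0 k u * gauss_pdf s2 (y - fade h (x i)))"

definition bit_MI :: "nat \<Rightarrow> (nat \<Rightarrow> real) \<Rightarrow> (nat \<Rightarrow> real ^ 'n) \<Rightarrow> real \<Rightarrow> real ^ 'n \<Rightarrow> nat \<Rightarrow> real" where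
  "bit_MI m P0 x s2 h k =
     (\<Sum>u\<in>{0, 1::nat}. PC P0 k u *
        (LINT y|lborel. bit_pdf m P0 x s2 h k u y *
            log 2 (bit_pdf m P0 x s2 h k u y / out_pdf m P0 x s2 h y)))"

definition EH2 :: "(real \<Rightarrow> real) \<Rightarrow> real" where
  "EH2 pH = (LINT t|lborel. t\<^sup>2 * pH t)"

text \<open>BICM-GMI as a function of SNR (N0 = E[H^2] E_s / SNR, noise variance N0/2);
  extended by its limit value 0 at SNR = 0.\<close>
definition bicm_gmi :: "nat \<Rightarrow> (nat \<Rightarrow> real) \<Rightarrow> (nat \<Rightarrow> real ^ 'n) \<Rightarrow> (real ^ 'n) measure \<Rightarrow> (real \<Rightarrow> real) \<Rightarrow> real \<Rightarrow> real" where
  "bicm_gmi m P0 x Hd pH snr =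
     (if snr \<le> 0 then 0
      else (let N0 = EH2 pH * Esym m P0 x / snr in
            \<Sum>k<m. LINT h|Hd. bit_MI m P0 x (N0 / 2) h k))"

definition first_order_optimal :: "nat \<Rightarrow> (nat \<Rightarrow> real) \<Rightarrow> (nat \<Rightarrow> real ^ 'n) \<Rightarrow> (real ^ 'n) measure \<Rightarrow> (real \<Rightarrow> real) \<Rightarrow> bool" where
  "first_order_optimal m P0 x Hd pH \<longleftrightarrow>
     (bicm_gmi m P0 x Hd pH has_real_derivative log 2 (exp 1)) (at_right 0)"

end

theory Submission
  imports Defs "HOL-Real_Asymp.Real_Asymp"
begin

text \<open>
  After rescaling the noise to unit variance, the information carried by bit \<open>k\<close> is the mean divergence
  of the two conditional output laws from the standard Gaussian minus the divergence of the output law.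
  For a Gaussian mixture with means \<open>e a\<^sub>i\<close> and weights \<open>w\<^sub>i\<close> this divergence is
  \<open>e\<^sup>2 |\<Sum> w\<^sub>i a\<^sub>i|\<^sup>2 / 2 + o(e\<^sup>2)\<close> and at most \<open>e\<^sup>2 \<Sum> w\<^sub>i |a\<^sub>i|\<^sup>2 / 2\<close>, so dominated convergence over the
  fading shows that the derivative at zero is \<open>log\<^sub>2 e\<close> times the ratio of
  \<open>\<Sum>\<^sub>k (E |E[X|C\<^sub>k]|\<^sup>2 - |E X|\<^sup>2)\<close> to \<open>E |X|\<^sup>2\<close>.
  The numerator is the energy of the orthogonal projection of \<open>X\<close> onto the sums of centred functions
  of single bits.  The ratio is therefore 1 iff \<open>X\<close> is such a sum, which is what the two conditions on
  the Hadamard coefficients say.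
\<close>

section \<open>The Gaussian density\<close>

text \<open>The substitution \<open>inverse t\<close> turns a limit at 0 from the right into one at
  infinity. Domination is asked only for \<open>t\<close> in (0, 1], the range in which the scaled
  divergences are controlled.\<close>

lemma dominated_convergence_at_right_0:
  fixes s :: "real \<Rightarrow> 'a \<Rightarrow> real" and f w :: "'a \<Rightarrow> real"
  assumes "f \<in> borel_measurable M" "\<And>t. s t \<in> borel_measurable M" "integrable M w"
    and lim: "\<And>x. ((\<lambda>t. s t x) \<longlongrightarrow> f x) (at_right 0)"
    and bound: "\<And>t x. 0 < t \<Longrightarrow> t \<le> 1 \<Longrightarrow> \<bar>s t x\<bar> \<le> w x"
  shows "((\<lambda>t. integral\<^sup>L M (s t)) \<longlongrightarrow> integral\<^sup>L M f) (at_right 0)"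
  unfolding filterlim_at_right_to_top
proof (rule integral_dominated_convergence_at_top)
  show "\<forall>\<^sub>F t in at_top. AE x in M. norm (s (inverse t) x) \<le> w x"
    using eventually_ge_at_top[of "1::real"]
    by eventually_elim (auto intro!: bound simp: field_simps)
  show "AE x in M. ((\<lambda>t. s (inverse t) x) \<longlongrightarrow> f x) at_top"
    using lim unfolding filterlim_at_right_to_top by auto
qed (use assms in auto)

text \<open>Serves for translation (recentring a Gaussian), reflection (odd integrands) and dilation
  (unit noise variance). Measurability suffices, because the integral takes the value 0 on both
  sides when the integrand is not integrable.\<close>

lemma integral_lborel_affine:
  fixes f :: "'a::euclidean_space \<Rightarrow> real" and t :: 'a
  assumes [measurable]: "f \<in> borel_measurable borel" and "c \<noteq> 0"
  shows "integral\<^sup>L lborel f = \<bar>c\<bar> ^ DIM('a) * (LINT x|lborel. f (t + c *\<^sub>R x))"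
proof -
  have "integral\<^sup>L lborel f =
      integral\<^sup>L (density (distr lborel borel (\<lambda>x. t + c *\<^sub>R x)) (\<lambda>_. ennreal (\<bar>c\<bar> ^ DIM('a)))) f"
    using lborel_affine[OF \<open>c \<noteq> 0\<close>, of t] by (simp add: ennreal_power)
  also have "\<dots> = \<bar>c\<bar> ^ DIM('a) * (LINT x|lborel. f (t + c *\<^sub>R x))"
    by (subst integral_density) (auto simp: integral_distr)
  finally show ?thesis .
qed

lemma gauss_pdf_measurable [measurable]: "gauss_pdf s \<in> borel_measurable borel"
  unfolding gauss_pdf_def by measurable

lemma gauss_pdf_pos: "0 < s \<Longrightarrow> 0 < gauss_pdf s y"
  by (simp add: gauss_pdf_def)

text \<open>Reduces the total mass of the density to the one-dimensional normal law, by
  Tonelli.\<close>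

lemma gauss_pdf_eq_prod:
  fixes y :: "real ^ 'n"
  assumes "0 < s"
  shows "gauss_pdf s y = (\<Prod>b\<in>Basis. normal_density 0 (sqrt s) (y \<bullet> b))"
proof -
  have n: "(norm y)\<^sup>2 = (\<Sum>b\<in>Basis. (y \<bullet> b)\<^sup>2)"
    unfolding power2_norm_eq_inner euclidean_inner[of y y] by (simp add: power2_eq_square)
  have c: "(2 * pi * s) powr (- real CARD('n) / 2) = (1 / sqrt (2 * pi * s)) ^ CARD('n)"
  proof -
    define q where "q = 2 * pi * s"
    have q: "0 < q" using assms by (simp add: q_def)
    have "q powr (- real CARD('n) / 2) = (q powr (1/2)) powr (- real CARD('n))"
      by (simp add: powr_powr)
    also have "\<dots> = inverse (sqrt q powr real CARD('n))"
      using q by (simp add: powr_half_sqrt powr_minus)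
    also have "\<dots> = (1 / sqrt q) ^ CARD('n)"
      using q by (simp add: powr_realpow power_one_over inverse_eq_divide)
    finally show ?thesis unfolding q_def .
  qed
  have "(\<Prod>b\<in>Basis. normal_density 0 (sqrt s) (y \<bullet> b))
      = (1 / sqrt (2 * pi * s)) ^ CARD('n) * (\<Prod>b\<in>Basis. exp (- (y \<bullet> b)\<^sup>2 / (2 * s)))"
    using assms by (simp add: normal_density_def prod.distrib prod_dividef power_divide)
  also have "(\<Prod>b\<in>Basis. exp (- (y \<bullet> b)\<^sup>2 / (2 * s))) = exp (- (norm y)\<^sup>2 / (2 * s))"
    by (simp add: n exp_sum[symmetric] sum_negf[symmetric] sum_divide_distrib)
  finally show ?thesis unfolding gauss_pdf_def c by simp
qed

lemma gauss_pdf_has_bochner_integral: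
  assumes "0 < s"
  shows "has_bochner_integral lborel (gauss_pdf s :: real ^ 'n \<Rightarrow> real) 1"
proof (rule has_bochner_integral_nn_integral)
  have one: "(\<integral>\<^sup>+t. ennreal (normal_density 0 (sqrt s) t) \<partial>lborel) = 1"
    using assms by (subst nn_integral_eq_integral) auto
  have "(\<integral>\<^sup>+y. ennreal (gauss_pdf s (y :: real ^ 'n)) \<partial>lborel)
      = (\<integral>\<^sup>+y. (\<Prod>b\<in>Basis. ennreal (normal_density 0 (sqrt s) ((y :: real ^ 'n) \<bullet> b))) \<partial>lborel)"
    by (intro nn_integral_cong) (simp add: gauss_pdf_eq_prod[OF assms] prod_ennreal)
  also have "\<dots> = 1"
    by (subst nn_integral_lborel_prod) (auto simp: one)
  finally show "(\<integral>\<^sup>+y. ennreal (gauss_pdf s (y :: real ^ 'n)) \<partial>lborel) = ennreal 1" by simp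
qed (use gauss_pdf_pos[OF assms] in \<open>auto intro: less_imp_le\<close>)

text \<open>Completing the square. The exponential factor is the likelihood ratio of the shifted
  against the centred Gaussian.\<close>

lemma gauss_pdf_shift:
  "gauss_pdf 1 (z - a) = gauss_pdf 1 z * exp (a \<bullet> z - (norm a)\<^sup>2 / 2)"
proof -
  have "- (norm (z - a))\<^sup>2 / 2 = - (norm z)\<^sup>2 / 2 + (a \<bullet> z - (norm a)\<^sup>2 / 2)"
    by (simp add: power2_norm_eq_inner inner_diff_left inner_diff_right inner_commute field_simps)
  then show ?thesis
    unfolding gauss_pdf_def by (simp add: exp_add[symmetric] mult.assoc)
qed

text \<open>Reduces noise of variance \<open>s\<close> to unit variance; the power of
  \<open>s\<close> in front is later cancelled by the Jacobian of the dilation.\<close>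

lemma gauss_pdf_scale:
  fixes z a :: "real ^ 'n"
  assumes "0 < s"
  shows "gauss_pdf s (sqrt s *\<^sub>R z - a)
    = s powr (- real CARD('n) / 2) * gauss_pdf 1 (z - (1 / sqrt s) *\<^sub>R a)"
proof -
  have "sqrt s *\<^sub>R z - a = sqrt s *\<^sub>R (z - (1 / sqrt s) *\<^sub>R a)"
    using assms by (simp add: scaleR_diff_right)
  then have "(norm (sqrt s *\<^sub>R z - a))\<^sup>2 = s * (norm (z - (1 / sqrt s) *\<^sub>R a))\<^sup>2"
    using assms by (simp only: norm_scaleR power_mult_distrib) simp
  then show ?thesis
    using assms unfolding gauss_pdf_def by (simp add: powr_mult)
qed

text \<open>Doubling the variance absorbs the exponential: expanding
  \<open>(norm z / 2 - c)\<^sup>2 \<ge> 0\<close> compares the exponents at the price of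
  \<open>exp (c\<^sup>2)\<close>, and \<open>2 powr (n / 2)\<close>, with n the dimension, is the
  ratio of the normalising constants.\<close>

lemma integrable_gauss_exp_norm:
  "integrable lborel (\<lambda>z :: real ^ 'n. gauss_pdf 1 z * exp (c * norm z))"
proof (rule Bochner_Integration.integrable_bound)
  let ?C = "2 powr (real CARD('n) / 2) * exp (c\<^sup>2)"
  show "integrable lborel (\<lambda>z :: real ^ 'n. ?C * gauss_pdf 2 z)"
    using gauss_pdf_has_bochner_integral[of 2, where 'n = 'n]
    by (intro integrable_mult_right) (auto simp: has_bochner_integral_iff)
  have "gauss_pdf 1 z * exp (c * norm z) \<le> ?C * gauss_pdf 2 z" for z :: "real ^ 'n"
  proof -
    have "0 \<le> (norm z / 2 - c)\<^sup>2" by simp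
    then have "- (norm z)\<^sup>2 / 2 + c * norm z \<le> c\<^sup>2 + - (norm z)\<^sup>2 / 4"
      by (simp add: power2_diff power_divide field_simps)
    then have "exp (- (norm z)\<^sup>2 / 2) * exp (c * norm z) \<le> exp (c\<^sup>2) * exp (- (norm z)\<^sup>2 / 4)"
      unfolding exp_add[symmetric] by simp
    moreover have "(2 * pi) powr (- real CARD('n) / 2)
        = 2 powr (real CARD('n) / 2) * (2 * pi * 2) powr (- real CARD('n) / 2)"
      by (simp add: powr_mult powr_minus powr_add[symmetric] field_simps)
    ultimately show ?thesis
      unfolding gauss_pdf_def by (simp add: mult_ac)
  qed
  then show "AE z in lborel. norm (gauss_pdf 1 (z :: real ^ 'n) * exp (c * norm z)) \<le> norm (?C * gauss_pdf 2 z)"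
    by (intro AE_I2) (simp add: gauss_pdf_pos less_imp_le abs_mult)
qed measurable

lemma integrable_gauss_bounded:
  fixes g :: "real ^ 'n \<Rightarrow> real"
  assumes [measurable]: "g \<in> borel_measurable borel" and "\<And>z. \<bar>g z\<bar> \<le> C * exp (c * norm z)"
  shows "integrable lborel (\<lambda>z. gauss_pdf 1 z * g z)"
proof (rule Bochner_Integration.integrable_bound)
  show "integrable lborel (\<lambda>z :: real ^ 'n. C * (gauss_pdf 1 z * exp (c * norm z)))"
    by (intro integrable_mult_right integrable_gauss_exp_norm)
  show "AE z in lborel. norm (gauss_pdf 1 z * g z) \<le> norm (C * (gauss_pdf 1 z * exp (c * norm z)))"
  proof (intro AE_I2)
    fix z :: "real ^ 'n"
    have "gauss_pdf 1 z * \<bar>g z\<bar> \<le> gauss_pdf 1 z * (C * exp (c * norm z))"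
      using assms(2) gauss_pdf_pos[of 1 z] by (intro mult_left_mono) auto
    also have "\<dots> \<le> \<bar>C * (gauss_pdf 1 z * exp (c * norm z))\<bar>"
      by (simp add: mult_ac)
    finally show "norm (gauss_pdf 1 z * g z) \<le> norm (C * (gauss_pdf 1 z * exp (c * norm z)))"
      using gauss_pdf_pos[of 1 z] by (simp add: abs_mult)
  qed
qed measurable

lemma gauss_exp_inner_has_bochner_integral:
  fixes a :: "real ^ 'n"
  shows "has_bochner_integral lborel (\<lambda>z. gauss_pdf 1 z * exp (a \<bullet> z - (norm a)\<^sup>2 / 2)) 1"
proof -
  have "integral\<^sup>L lborel (gauss_pdf 1 :: real ^ 'n \<Rightarrow> real) = (LINT z|lborel. gauss_pdf 1 (z - a))"
    by (subst integral_lborel_affine[of _ 1 "- a"]) auto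
  then have "(LINT z|lborel. gauss_pdf 1 (z - a)) = 1"
    using gauss_pdf_has_bochner_integral[of 1, where 'n = 'n] by (simp add: has_bochner_integral_iff)
  moreover have "integrable lborel (\<lambda>z. gauss_pdf 1 z * exp (a \<bullet> z - (norm a)\<^sup>2 / 2))"
  proof (rule integrable_gauss_bounded)
    show "\<bar>exp (a \<bullet> z - (norm a)\<^sup>2 / 2)\<bar> \<le> 1 * exp (norm a * norm z)" for z
      using norm_cauchy_schwarz[of a z] by (simp add: add_increasing2 diff_le_eq)
  qed measurable
  ultimately show ?thesis by (simp add: has_bochner_integral_iff gauss_pdf_shift)
qed

text \<open>The integrand is odd, so the reflection of \<open>z\<close> changes its sign.\<close>

lemma gauss_mean:
  fixes a :: "real ^ 'n"
  shows "has_bochner_integral lborel (\<lambda>z. gauss_pdf 1 z * (a \<bullet> z)) 0"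
proof -
  have "(LINT z|lborel. gauss_pdf 1 z * (a \<bullet> z)) = (LINT z|lborel. - (gauss_pdf 1 z * (a \<bullet> z)))"
    by (subst integral_lborel_affine[of _ "-1" 0]) (auto simp: gauss_pdf_def)
  then have "(LINT z|lborel. gauss_pdf 1 z * (a \<bullet> z)) = 0" by simp
  moreover have "integrable lborel (\<lambda>z. gauss_pdf 1 z * (a \<bullet> z))"
  proof (rule integrable_gauss_bounded)
    fix z :: "real ^ 'n"
    have "norm z \<le> exp (1 * norm z)" using exp_ge_add_one_self[of "norm z"] unfolding mult_1 by linarith
    then show "\<bar>a \<bullet> z\<bar> \<le> norm a * exp (1 * norm z)"
      using Cauchy_Schwarz_ineq2[of a z] by (meson mult_left_mono norm_ge_zero order_trans)
  qed measurable
  ultimately show ?thesis by (simp add: has_bochner_integral_iff)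
qed

section \<open>Divergence of Gaussian mixtures\<close>

text \<open>Likelihood ratio, and below its divergence in nats, of the Gaussian mixture with means \<open>a i\<close> and
  weights \<open>w i\<close> against the standard Gaussian.\<close>

definition mix_lr :: "'i set \<Rightarrow> ('i \<Rightarrow> real) \<Rightarrow> ('i \<Rightarrow> real ^ 'n) \<Rightarrow> real ^ 'n \<Rightarrow> real" where
  "mix_lr A w a z = (\<Sum>i\<in>A. w i * exp (a i \<bullet> z - (norm (a i))\<^sup>2 / 2))"

definition mix_KL :: "'i set \<Rightarrow> ('i \<Rightarrow> real) \<Rightarrow> ('i \<Rightarrow> real ^ 'n) \<Rightarrow> real" where
  "mix_KL A w a = (LINT z|lborel. gauss_pdf 1 z * (mix_lr A w a z * ln (mix_lr A w a z)))"

definition prob_weights :: "'i set \<Rightarrow> ('i \<Rightarrow> real) \<Rightarrow> bool" where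
  "prob_weights A w \<longleftrightarrow> finite A \<and> (\<forall>i\<in>A. 0 \<le> w i) \<and> sum w A = 1"

lemma mix_lr_measurable [measurable]: "mix_lr A w a \<in> borel_measurable borel"
  unfolding mix_lr_def by measurable

text \<open>Every exponent lies in \<open>[- \<kappa> z, \<kappa> z]\<close>, and a weighted average
  stays between the extreme values. The lower bound is what controls the logarithm.\<close>

lemma mix_lr_bounds:
  fixes a :: "'i \<Rightarrow> real ^ 'n"
  assumes w: "prob_weights A w" and R: "\<And>i. i \<in> A \<Longrightarrow> norm (a i) \<le> R"
  defines "\<kappa> z \<equiv> R * norm z + R\<^sup>2 / 2"
  shows "exp (- \<kappa> z) \<le> mix_lr A w a z" and "mix_lr A w a z \<le> exp (\<kappa> z)"
proof -
  have e: "\<bar>a i \<bullet> z - (norm (a i))\<^sup>2 / 2\<bar> \<le> \<kappa> z" if "i \<in> A" for i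
  proof -
    have "\<bar>a i \<bullet> z\<bar> \<le> R * norm z"
      using Cauchy_Schwarz_ineq2[of "a i" z] mult_right_mono[OF R[OF that], of "norm z"] by simp
    moreover have "(norm (a i))\<^sup>2 \<le> R\<^sup>2" using R[OF that] by (intro power_mono) auto
    ultimately show ?thesis
      unfolding \<kappa>_def by (smt (verit) zero_le_power2 divide_right_mono divide_nonneg_nonneg)
  qed
  have "(\<Sum>i\<in>A. w i * exp (- \<kappa> z)) \<le> mix_lr A w a z"
    unfolding mix_lr_def using w e
    by (intro sum_mono mult_left_mono) (auto simp: prob_weights_def abs_le_iff, fastforce)
  then show "exp (- \<kappa> z) \<le> mix_lr A w a z"
    using w by (simp add: prob_weights_def sum_distrib_right[symmetric])
  have "mix_lr A w a z \<le> (\<Sum>i\<in>A. w i * exp (\<kappa> z))"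
    unfolding mix_lr_def using w e
    by (intro sum_mono mult_left_mono) (auto simp: prob_weights_def abs_le_iff)
  then show "mix_lr A w a z \<le> exp (\<kappa> z)"
    using w by (simp add: prob_weights_def sum_distrib_right[symmetric])
qed

lemma prob_weights_norm_bound:
  assumes "prob_weights A w"
  shows "\<exists>R\<ge>0. \<forall>i\<in>A. norm (a i) \<le> R"
proof (intro exI conjI ballI)
  show "0 \<le> (\<Sum>i\<in>A. norm (a i))" by (simp add: sum_nonneg)
  show "norm (a i) \<le> (\<Sum>i\<in>A. norm (a i))" if "i \<in> A" for i
    using that assms by (intro member_le_sum) (auto simp: prob_weights_def)
qed

lemma mix_lr_pos:
  assumes "prob_weights A w"
  shows "0 < mix_lr A w a z"
proof -
  obtain R where R: "0 \<le> R" "\<And>i. i \<in> A \<Longrightarrow> norm (a i) \<le> R"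
    using prob_weights_norm_bound[OF assms, of a] by blast
  show ?thesis
    by (rule less_le_trans[OF exp_gt_zero mix_lr_bounds(1)[OF assms R(2)]])
qed

lemma abs_ln_mix_lr_le:
  assumes "prob_weights A w" and "\<And>i. i \<in> A \<Longrightarrow> norm (a i) \<le> R"
  shows "\<bar>ln (mix_lr A w a z)\<bar> \<le> R * norm z + R\<^sup>2 / 2"
proof -
  note b = mix_lr_bounds[OF assms, where z = z]
  have "ln (mix_lr A w a z) \<le> R * norm z + R\<^sup>2 / 2"
    using ln_mono[OF b(2)] mix_lr_pos[OF assms(1), of a z] by simp
  moreover have "- (R * norm z + R\<^sup>2 / 2) \<le> ln (mix_lr A w a z)"
    using b(1) mix_lr_pos[OF assms(1), of a z] by (simp add: ln_ge_iff)
  ultimately show ?thesis by linarith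
qed

text \<open>Two mixtures are allowed because the cross terms of the mutual information pair the law
  given one bit with the logarithm of the full mixture. The inclusion \<open>B \<subseteq> A\<close>
  lets one radius bound both.\<close>

lemma integrable_gauss_mix_lr_ln:
  fixes a :: "'i \<Rightarrow> real ^ 'n"
  assumes "prob_weights A w" "prob_weights B v" and sub: "B \<subseteq> A"
  shows "integrable lborel (\<lambda>z. gauss_pdf 1 z * (mix_lr B v a z * ln (mix_lr A w a z)))"
proof -
  obtain R where R: "0 \<le> R" "\<And>i. i \<in> A \<Longrightarrow> norm (a i) \<le> R"
    using prob_weights_norm_bound[OF assms(1), of a] by blast
  show ?thesis
  proof (rule integrable_gauss_bounded)
    fix z :: "real ^ 'n"
    let ?k = "R * norm z + R\<^sup>2 / 2"
    have "\<bar>ln (mix_lr A w a z)\<bar> \<le> ?k" by (rule abs_ln_mix_lr_le[OF assms(1) R(2)])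
    also have "\<dots> \<le> exp ?k" using exp_ge_add_one_self[of ?k] by linarith
    finally have "\<bar>ln (mix_lr A w a z)\<bar> \<le> exp ?k" .
    moreover have "\<bar>mix_lr B v a z\<bar> \<le> exp ?k"
      using mix_lr_bounds(2)[OF assms(2), where a = a and R = R and z = z] mix_lr_pos[OF assms(2), of a z] R sub by auto
    ultimately have "\<bar>mix_lr B v a z\<bar> * \<bar>ln (mix_lr A w a z)\<bar> \<le> exp ?k * exp ?k"
      by (intro mult_mono) auto
    also have "\<dots> = exp (R\<^sup>2) * exp (2 * R * norm z)" by (simp add: exp_add[symmetric])
    finally show "\<bar>mix_lr B v a z * ln (mix_lr A w a z)\<bar> \<le> exp (R\<^sup>2) * exp (2 * R * norm z)"
      by (simp add: abs_mult)
  qed measurable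
qed

lemma gauss_mix_lr_has_bochner_integral:
  fixes a :: "'i \<Rightarrow> real ^ 'n"
  assumes "prob_weights A w"
  shows "has_bochner_integral lborel (\<lambda>z. gauss_pdf 1 z * mix_lr A w a z) 1"
proof -
  have "has_bochner_integral lborel
      (\<lambda>z. \<Sum>i\<in>A. w i * (gauss_pdf 1 z * exp (a i \<bullet> z - (norm (a i))\<^sup>2 / 2))) (\<Sum>i\<in>A. w i * 1)"
    by (intro has_bochner_integral_sum has_bochner_integral_mult_right
        gauss_exp_inner_has_bochner_integral)
  then show ?thesis
    using assms unfolding mix_lr_def
    by (simp add: prob_weights_def sum_distrib_left mult_ac)
qed

text \<open>The added terms \<open>- L + 1\<close> integrate to zero, as the likelihood ratio L has
  mean 1. They make the integrand nonnegative and quadratically small near \<open>L = 1\<close>, as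
  the expansion and its domination require.\<close>

lemma mix_KL_eq:
  fixes a :: "'i \<Rightarrow> real ^ 'n"
  assumes "prob_weights A w"
  shows "mix_KL A w a = (LINT z|lborel. gauss_pdf 1 z *
    (mix_lr A w a z * ln (mix_lr A w a z) - mix_lr A w a z + 1))"
proof -
  have "has_bochner_integral lborel
      (\<lambda>z. gauss_pdf 1 z * (mix_lr A w a z * ln (mix_lr A w a z))) (mix_KL A w a)"
    unfolding mix_KL_def
    using integrable_gauss_mix_lr_ln[OF assms assms order_refl, of a]
    by (simp add: has_bochner_integral_iff)
  from has_bochner_integral_add[OF has_bochner_integral_diff[OF this
      gauss_mix_lr_has_bochner_integral[OF assms, of a]] gauss_pdf_has_bochner_integral[of 1]]
  show ?thesis by (simp add: has_bochner_integral_iff algebra_simps)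
qed

text \<open>The left side is the tangent of the convex function \<open>t * ln t\<close> at
  \<open>t = y\<close>, evaluated at \<open>x\<close>.\<close>

lemma mult_ln_tangent:
  fixes x y :: real
  assumes "0 < x" "0 < y"
  shows "x * ln y + x - y \<le> x * ln x"
proof -
  have "ln (y / x) \<le> y / x - 1" using assms by (intro ln_le_minus_one) auto
  then have "x * (ln y - ln x) \<le> x * (y / x - 1)"
    using assms by (intro mult_left_mono) (auto simp: ln_div)
  then show ?thesis using assms by (simp add: algebra_simps)
qed

text \<open>Jensen's inequality for \<open>t * ln t\<close>: average the tangent at the mean
  \<open>S\<close>; its linear terms cancel since the weights sum to 1.\<close>

lemma log_sum_inequality:
  fixes L :: "'i \<Rightarrow> real"
  assumes "prob_weights A w" and pos: "\<And>i. i \<in> A \<Longrightarrow> 0 < L i" and "0 < (\<Sum>i\<in>A. w i * L i)"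
  shows "(\<Sum>i\<in>A. w i * L i) * ln (\<Sum>i\<in>A. w i * L i) \<le> (\<Sum>i\<in>A. w i * (L i * ln (L i)))"
proof -
  define S where "S = (\<Sum>i\<in>A. w i * L i)"
  have "(\<Sum>i\<in>A. w i * (L i * ln S + L i - S)) \<le> (\<Sum>i\<in>A. w i * (L i * ln (L i)))"
  proof (intro sum_mono mult_left_mono)
    fix i assume "i \<in> A"
    then show "L i * ln S + L i - S \<le> L i * ln (L i)" "0 \<le> w i"
      using mult_ln_tangent[of "L i" S] assms by (auto simp: S_def prob_weights_def)
  qed
  moreover have "(\<Sum>i\<in>A. w i * (L i * ln S + L i - S)) = S * ln S + S - S * sum w A"
  proof -
    have "(\<Sum>i\<in>A. w i * (L i * ln S + L i - S)) = (\<Sum>i\<in>A. w i * L i * ln S + w i * L i - w i * S)"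
      by (simp add: algebra_simps)
    also have "\<dots> = S * ln S + S - S * sum w A"
      by (simp only: sum.distrib sum_subtractf sum_distrib_right[symmetric] S_def[symmetric]) simp
    finally show ?thesis .
  qed
  ultimately show ?thesis using assms(1) by (simp add: S_def prob_weights_def)
qed

lemma mix_KL_nonneg: "prob_weights A w \<Longrightarrow> 0 \<le> mix_KL A w a"
  unfolding mix_KL_eq
proof (intro integral_nonneg_AE AE_I2 mult_nonneg_nonneg)
  fix z
  assume "prob_weights A w"
  then show "0 \<le> mix_lr A w a z * ln (mix_lr A w a z) - mix_lr A w a z + 1"
    using mult_ln_tangent[of "mix_lr A w a z" 1] mix_lr_pos[of A w a z] by simp
qed (simp add: gauss_pdf_pos less_imp_le)

text \<open>Recentring at \<open>a\<close> turns the logarithm into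
  \<open>a \<bullet> z + (norm a)\<^sup>2 / 2\<close> under the standard Gaussian, whose linear part
  has mean zero.\<close>

lemma gauss_shift_KL: "has_bochner_integral lborel
    (\<lambda>z. gauss_pdf 1 z * (exp (a \<bullet> z - (norm a)\<^sup>2 / 2) * (a \<bullet> z - (norm a)\<^sup>2 / 2))) ((norm a)\<^sup>2 / 2)"
proof -
  let ?g = "\<lambda>z. gauss_pdf 1 z * (exp (a \<bullet> z - (norm a)\<^sup>2 / 2) * (a \<bullet> z - (norm a)\<^sup>2 / 2))"
  \<comment> \<open>A single shifted Gaussian is a mixture with one component, so the integrability
    result for mixtures applies.\<close>
  have p: "prob_weights {()} (\<lambda>_. 1)" by (simp add: prob_weights_def)
  have i: "integrable lborel ?g"
    using integrable_gauss_mix_lr_ln[OF p p order_refl, of "\<lambda>_. a"] by (simp add: mix_lr_def)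
  have "integral\<^sup>L lborel ?g = (LINT z|lborel. gauss_pdf 1 z * (a \<bullet> z) + (norm a)\<^sup>2 / 2 * gauss_pdf 1 z)"
    using gauss_pdf_shift[of "_ + a" a, symmetric]
    by (subst integral_lborel_affine[of _ 1 a])
       (auto simp: algebra_simps power2_norm_eq_inner intro!: Bochner_Integration.integral_cong)
  also have "\<dots> = (norm a)\<^sup>2 / 2"
    using has_bochner_integral_add[OF gauss_mean[of a] has_bochner_integral_mult_right[OF
        gauss_pdf_has_bochner_integral[of 1], of "(norm a)\<^sup>2 / 2"]]
    by (simp add: has_bochner_integral_iff)
  finally show ?thesis using i by (simp add: has_bochner_integral_iff)
qed

text \<open>Convexity of the divergence: Jensen's inequality at each \<open>z\<close> bounds the
  mixture by the weighted divergences of its components, which are known exactly.\<close>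

lemma mix_KL_le:
  fixes a :: "'i \<Rightarrow> real ^ 'n"
  assumes "prob_weights A w"
  shows "mix_KL A w a \<le> (\<Sum>i\<in>A. w i * ((norm (a i))\<^sup>2 / 2))"
proof -
  have b: "has_bochner_integral lborel (\<lambda>z. \<Sum>i\<in>A. w i * (gauss_pdf 1 z *
      (exp (a i \<bullet> z - (norm (a i))\<^sup>2 / 2) * (a i \<bullet> z - (norm (a i))\<^sup>2 / 2))))
      (\<Sum>i\<in>A. w i * ((norm (a i))\<^sup>2 / 2))"
    by (intro has_bochner_integral_sum has_bochner_integral_mult_right gauss_shift_KL)
  have "mix_KL A w a \<le> (LINT z|lborel. (\<Sum>i\<in>A. w i * (gauss_pdf 1 z *
      (exp (a i \<bullet> z - (norm (a i))\<^sup>2 / 2) * (a i \<bullet> z - (norm (a i))\<^sup>2 / 2)))))"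
    unfolding mix_KL_def
  proof (intro integral_mono integrable_gauss_mix_lr_ln[OF assms assms order_refl])
    show "integrable lborel (\<lambda>z. \<Sum>i\<in>A. w i * (gauss_pdf 1 z *
      (exp (a i \<bullet> z - (norm (a i))\<^sup>2 / 2) * (a i \<bullet> z - (norm (a i))\<^sup>2 / 2))))"
      using b by (simp add: has_bochner_integral_iff)
    fix z
    have "gauss_pdf 1 z * (mix_lr A w a z * ln (mix_lr A w a z)) \<le> gauss_pdf 1 z *
       (\<Sum>i\<in>A. w i * (exp (a i \<bullet> z - (norm (a i))\<^sup>2 / 2) * ln (exp (a i \<bullet> z - (norm (a i))\<^sup>2 / 2))))"
      using mix_lr_pos[OF assms, of a z] gauss_pdf_pos[of 1 z] unfolding mix_lr_def
      by (intro mult_left_mono log_sum_inequality[OF assms]) auto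
    then show "gauss_pdf 1 z * (mix_lr A w a z * ln (mix_lr A w a z)) \<le> (\<Sum>i\<in>A. w i * (gauss_pdf 1 z *
      (exp (a i \<bullet> z - (norm (a i))\<^sup>2 / 2) * (a i \<bullet> z - (norm (a i))\<^sup>2 / 2))))"
      by (simp add: sum_distrib_left mult_ac)
  qed
  also have "\<dots> = (\<Sum>i\<in>A. w i * ((norm (a i))\<^sup>2 / 2))"
    using b by (simp add: has_bochner_integral_iff)
  finally show ?thesis .
qed

section \<open>Second-order expansion of the divergence for small means\<close>

lemma mult_ln_quadratic_bound:
  fixes t :: real
  assumes "0 < t"
  shows "0 \<le> t * ln t - t + 1" and "t * ln t - t + 1 \<le> (t - 1)\<^sup>2"
proof -
  show "0 \<le> t * ln t - t + 1" using mult_ln_tangent[OF assms, of 1] by simp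
  have "t * ln t \<le> t * (t - 1)" using assms by (intro mult_left_mono ln_le_minus_one) auto
  then show "t * ln t - t + 1 \<le> (t - 1)\<^sup>2" by (simp add: power2_eq_square algebra_simps)
qed

text \<open>To second order \<open>t * ln t - t + 1\<close> is \<open>(t - 1)\<^sup>2 / 2\<close>,
  and \<open>L e - 1\<close> is \<open>b * e\<close> to first order.\<close>

lemma mult_ln_second_order_limit:
  fixes L :: "real \<Rightarrow> real"
  assumes L: "(L has_real_derivative b) (at 0)" and "L 0 = 1"
  shows "((\<lambda>e. (L e * ln (L e) - L e + 1) / e\<^sup>2) \<longlongrightarrow> b\<^sup>2 / 2) (at_right 0)"
proof -
  \<comment> \<open>The value 1/2 at \<open>t = 1\<close> is the continuous extension. It is needed
    because \<open>L e = 1\<close> may occur for \<open>e > 0\<close>.\<close>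
  define \<psi> :: "real \<Rightarrow> real" where "\<psi> t = (if t = 1 then 1/2 else (t * ln t - t + 1) / (t - 1)\<^sup>2)" for t
  have "((\<lambda>t::real. (t * ln t - t + 1) / (t - 1)\<^sup>2) \<longlongrightarrow> 1/2) (at 1)" by real_asymp
  then have "(\<psi> \<longlongrightarrow> 1/2) (at 1)"
    by (rule Lim_transform_eventually) (auto simp: \<psi>_def eventually_at_filter)
  then have "isCont \<psi> 1" by (simp add: isCont_def \<psi>_def)
  moreover have "(L \<longlongrightarrow> 1) (at_right 0)"
    using DERIV_isCont[OF L] \<open>L 0 = 1\<close> by (auto simp: isCont_def intro: filterlim_at_split[THEN iffD1, THEN conjunct2])
  ultimately have "((\<lambda>e. \<psi> (L e)) \<longlongrightarrow> 1/2) (at_right 0)"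
    using isCont_tendsto_compose[of 1 \<psi> L] by (simp add: \<psi>_def)
  moreover have "((\<lambda>e. (L e - 1) / e) \<longlongrightarrow> b) (at_right 0)"
    using L \<open>L 0 = 1\<close> unfolding DERIV_def by (auto simp: filterlim_at_split)
  ultimately have "((\<lambda>e. \<psi> (L e) * ((L e - 1) / e)\<^sup>2) \<longlongrightarrow> 1/2 * b\<^sup>2) (at_right 0)"
    by (intro tendsto_intros)
  \<comment> \<open>If \<open>L e = 1\<close>, both sides are 0; otherwise the factor
    \<open>(L e - 1)\<^sup>2\<close> cancels.\<close>
  moreover have "\<psi> (L e) * ((L e - 1) / e)\<^sup>2 = (L e * ln (L e) - L e + 1) / e\<^sup>2" for e
    by (simp add: \<psi>_def power_divide)
  ultimately show ?thesis by simp
qed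

lemma exp_minus_one_le: "0 \<le> (x::real) \<Longrightarrow> exp x - 1 \<le> x * exp x"
proof -
  have "1 + - x \<le> exp (- x)" by (rule exp_ge_add_one_self)
  then have "exp x * (1 - x) \<le> exp x * exp (- x)" by (intro mult_left_mono) auto
  then show ?thesis by (simp add: exp_minus algebra_simps)
qed

text \<open>The limit is taken under the integral: the second-order expansion applies at each
  \<open>z\<close>, and an exponential in \<open>norm z\<close> dominates uniformly in
  \<open>e \<le> 1\<close>.\<close>

lemma mix_KL_limit_integral:
  fixes a :: "'i \<Rightarrow> real ^ 'n"
  assumes "prob_weights A w"
  shows "((\<lambda>e. mix_KL A w (\<lambda>i. e *\<^sub>R a i) / e\<^sup>2) \<longlongrightarrow>
     (LINT z|lborel. gauss_pdf 1 z * (((\<Sum>i\<in>A. w i *\<^sub>R a i) \<bullet> z)\<^sup>2 / 2))) (at_right 0)"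
proof -
  obtain R where R: "0 \<le> R" "\<And>i. i \<in> A \<Longrightarrow> norm (a i) \<le> R"
    using prob_weights_norm_bound[OF assms, of a] by blast
  let ?L = "\<lambda>e z. mix_lr A w (\<lambda>i. e *\<^sub>R a i) z"
  have "((\<lambda>e. LINT z|lborel. gauss_pdf 1 z * ((?L e z * ln (?L e z) - ?L e z + 1) / e\<^sup>2)) \<longlongrightarrow>
     (LINT z|lborel. gauss_pdf 1 z * (((\<Sum>i\<in>A. w i *\<^sub>R a i) \<bullet> z)\<^sup>2 / 2))) (at_right 0)"
  proof (rule dominated_convergence_at_right_0)
    show "integrable lborel (\<lambda>z :: real ^ 'n. exp (2 * R\<^sup>2) * (gauss_pdf 1 z * exp (4 * R * norm z)))"
      by (intro integrable_mult_right integrable_gauss_exp_norm)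
    fix z :: "real ^ 'n"
    \<comment> \<open>The squared-norm term in the exponent is of order \<open>e\<^sup>2\<close> and
      so does not contribute to the derivative at 0.\<close>
    have "((\<lambda>e. ?L e z) has_real_derivative (\<Sum>i\<in>A. w i * (a i \<bullet> z))) (at 0)"
      unfolding mix_lr_def inner_scaleR_left norm_scaleR power_mult_distrib power2_abs
      by (auto intro!: derivative_eq_intros sum.cong)
    moreover have "?L 0 z = 1" using assms by (simp add: mix_lr_def prob_weights_def)
    ultimately have "((\<lambda>e. (?L e z * ln (?L e z) - ?L e z + 1) / e\<^sup>2) \<longlongrightarrow>
        (\<Sum>i\<in>A. w i * (a i \<bullet> z))\<^sup>2 / 2) (at_right 0)"
      by (rule mult_ln_second_order_limit)
    then show "((\<lambda>e. gauss_pdf 1 z * ((?L e z * ln (?L e z) - ?L e z + 1) / e\<^sup>2)) \<longlongrightarrow>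
        gauss_pdf 1 z * (((\<Sum>i\<in>A. w i *\<^sub>R a i) \<bullet> z)\<^sup>2 / 2)) (at_right 0)"
      by (intro tendsto_mult tendsto_const) (simp add: inner_sum_left)
    fix e :: real assume e: "0 < e" "e \<le> 1"
    define k where "k = R * norm z + R\<^sup>2 / 2"
    have k0: "0 \<le> k" using R by (simp add: k_def)
    \<comment> \<open>The exponent bound of \<open>mix_lr_bounds\<close> for means of length at most
      \<open>e * R\<close>. As \<open>e \<le> 1\<close>, it is at most \<open>e * k\<close>; this
      factor \<open>e\<close>, once squared, cancels the division by
      \<open>e\<^sup>2\<close>.\<close>
    define k' where "k' = e * R * norm z + (e * R)\<^sup>2 / 2"
    have k'0: "0 \<le> k'" using R e by (simp add: k'_def)
    have "e\<^sup>2 * R\<^sup>2 \<le> e * R\<^sup>2" using e by (intro mult_right_mono) (auto simp: power2_eq_square)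
    then have k': "k' \<le> e * k" unfolding k_def k'_def by (simp add: power_mult_distrib algebra_simps)
    have eR: "\<And>i. i \<in> A \<Longrightarrow> norm (e *\<^sub>R a i) \<le> e * R"
      using R e by (simp add: mult_left_mono)
    note b = mix_lr_bounds[where a = "\<lambda>i. e *\<^sub>R a i" and z = z, OF assms eR, folded k'_def]
    have pos: "0 < ?L e z" by (rule mix_lr_pos[OF assms])
    \<comment> \<open>Together these give \<open>1 - exp (- k') \<le> exp k' - 1\<close>, so the
      upper deviation from 1 also bounds the lower one.\<close>
    have "1 + - k' \<le> exp (- k')" "1 + k' \<le> exp k'" by (rule exp_ge_add_one_self)+
    then have "\<bar>?L e z - 1\<bar> \<le> exp k' - 1"
      using b unfolding abs_le_iff by linarith
    also have "\<dots> \<le> k' * exp k'" using k'0 by (rule exp_minus_one_le)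
    also have "\<dots> \<le> (e * k) * exp k"
      using k' k'0 k0 e mult_right_mono[of e 1 k] by (intro mult_mono) auto
    \<comment> \<open>The crude bound \<open>k \<le> exp k\<close> leaves a pure exponential, which
      has a finite Gaussian integral.\<close>
    also have "\<dots> \<le> (e * exp k) * exp k"
      using e exp_ge_add_one_self[of k] by (intro mult_right_mono mult_left_mono) (linarith | simp)+
    finally have "\<bar>?L e z - 1\<bar>\<^sup>2 \<le> (e * exp k * exp k)\<^sup>2" by (intro power_mono) auto
    then have "(?L e z - 1)\<^sup>2 \<le> e\<^sup>2 * exp (4 * k)"
      by (simp add: power_mult_distrib exp_double[symmetric] exp_add[symmetric] mult.assoc)
    then have L2: "?L e z * ln (?L e z) - ?L e z + 1 \<le> e\<^sup>2 * exp (4 * k)"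
      using mult_ln_quadratic_bound(2)[OF pos] by linarith
    have "(?L e z * ln (?L e z) - ?L e z + 1) / e\<^sup>2 \<le> exp (2 * R\<^sup>2) * exp (4 * R * norm z)"
    proof -
      have "exp (4 * k) = exp (2 * R\<^sup>2) * exp (4 * R * norm z)"
        by (simp add: k_def exp_add[symmetric])
      then show ?thesis
        using e L2 by (simp add: pos_divide_le_eq mult.commute)
    qed
    then have "gauss_pdf 1 z * ((?L e z * ln (?L e z) - ?L e z + 1) / e\<^sup>2)
        \<le> gauss_pdf 1 z * (exp (2 * R\<^sup>2) * exp (4 * R * norm z))"
      using gauss_pdf_pos[of 1 z] by (intro mult_left_mono) auto
    moreover have "0 \<le> gauss_pdf 1 z * ((?L e z * ln (?L e z) - ?L e z + 1) / e\<^sup>2)"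
      using gauss_pdf_pos[of 1 z] mult_ln_quadratic_bound(1)[OF pos] by simp
    ultimately show "\<bar>gauss_pdf 1 z * ((?L e z * ln (?L e z) - ?L e z + 1) / e\<^sup>2)\<bar>
        \<le> exp (2 * R\<^sup>2) * (gauss_pdf 1 z * exp (4 * R * norm z))"
      by (simp add: mult_ac)
  qed measurable
  then show ?thesis by (simp add: mix_KL_eq[OF assms])
qed

text \<open>The second moment is read off from the exactly known divergence of a shifted Gaussian.\<close>

lemma gauss_second_moment:
  fixes a :: "real ^ 'n"
  shows "(LINT z|lborel. gauss_pdf 1 z * ((a \<bullet> z)\<^sup>2 / 2)) = (norm a)\<^sup>2 / 2"
proof -
  have p: "prob_weights {()} (\<lambda>_. 1)" by (simp add: prob_weights_def)
  have "mix_KL {()} (\<lambda>_. 1) (\<lambda>_. e *\<^sub>R a) = e\<^sup>2 * ((norm a)\<^sup>2 / 2)" for e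
    using gauss_shift_KL[of "e *\<^sub>R a"]
    by (simp add: mix_KL_def mix_lr_def has_bochner_integral_iff power_mult_distrib)
  moreover have "\<forall>\<^sub>F e in at_right 0. e\<^sup>2 * ((norm a)\<^sup>2 / 2) / e\<^sup>2 = (norm a)\<^sup>2 / 2"
    by (auto simp: eventually_at_filter)
  ultimately have "((\<lambda>e. mix_KL {()} (\<lambda>_. 1) (\<lambda>_. e *\<^sub>R a) / e\<^sup>2) \<longlongrightarrow> (norm a)\<^sup>2 / 2) (at_right 0)"
    by (simp only: tendsto_eventually)
  moreover have "((\<lambda>e. mix_KL {()} (\<lambda>_. 1) (\<lambda>_. e *\<^sub>R a) / e\<^sup>2) \<longlongrightarrow>
      (LINT z|lborel. gauss_pdf 1 z * ((a \<bullet> z)\<^sup>2 / 2))) (at_right 0)"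
    using mix_KL_limit_integral[OF p, of "\<lambda>_. a"] by simp
  ultimately show ?thesis
    by (rule tendsto_unique[OF trivial_limit_at_right_real, symmetric])
qed

lemma mix_KL_limit:
  assumes "prob_weights A w"
  shows "((\<lambda>e. mix_KL A w (\<lambda>i. e *\<^sub>R a i) / e\<^sup>2) \<longlongrightarrow> (norm (\<Sum>i\<in>A. w i *\<^sub>R a i))\<^sup>2 / 2) (at_right 0)"
  using mix_KL_limit_integral[OF assms] unfolding gauss_second_moment .

section \<open>Independent bits and the Hadamard transform\<close>

lemma bitv_eq_bit: "bitv i k = of_bool (bit i k)"
  by (simp add: bitv_def bit_iff_odd odd_iff_mod_2_eq_one)

lemma bitv_cases: "bitv i k = 0 \<or> bitv i k = 1"
  by (simp add: bitv_eq_bit)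

lemma bitv_zero [simp]: "bitv 0 k = 0"
  by (simp add: bitv_def)

lemma bitv_power_two: "bitv (2 ^ j) k = of_bool (j = k)"
  by (auto simp: bitv_eq_bit bit_exp_iff)

lemma bitv_eqI:
  assumes "i < 2 ^ m" "j < 2 ^ m" "\<And>k. k < m \<Longrightarrow> bitv i k = bitv j k"
  shows "i = j"
proof (rule bit_eqI)
  fix k
  have "\<not> bit i k" "\<not> bit j k" if "m \<le> k"
  proof -
    have "(2::nat) ^ m \<le> 2 ^ k" using that by (simp add: power_increasing)
    then have "i < 2 ^ k" "j < 2 ^ k" using assms(1,2) by linarith+
    then show "\<not> bit i k" "\<not> bit j k" by (simp_all add: bit_iff_odd)
  qed
  then show "bit i k = bit j k"
    using assms(3)[of k] unfolding bitv_eq_bit of_bool_eq_iff by (cases "k < m") auto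
qed

lemma bitv_top_bit:
  assumes "i < 2 ^ m"
  shows "bitv i m = 0" "bitv (2 ^ m + i) m = 1"
    "k < m \<Longrightarrow> bitv (2 ^ m + i) k = bitv i k"
proof -
  show "bitv i m = 0" "bitv (2 ^ m + i) m = 1" using assms by (simp_all add: bitv_def)
  assume "k < m"
  then have "(2::nat) ^ m = 2 ^ k * (2 * 2 ^ (m - Suc k))"
    by (simp flip: power_Suc power_add)
  then have "(2 ^ m + i) div 2 ^ k = 2 * 2 ^ (m - Suc k) + i div 2 ^ k"
    by simp
  then show "bitv (2 ^ m + i) k = bitv i k" by (simp add: bitv_def)
qed

lemma sum_lessThan_add:
  fixes f :: "nat \<Rightarrow> 'a::comm_monoid_add"
  shows "(\<Sum>i<n + k. f i) = (\<Sum>i<n. f i) + (\<Sum>i<k. f (n + i))"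
  by (induction k) (simp_all add: add.assoc)

text \<open>Distributivity, proved by splitting the indices at \<open>2 ^ m\<close>, that is, by the
  top bit. Both the independence of the bits and the orthogonality of the Hadamard rows come from
  it.\<close>

lemma sum_prod_bits:
  fixes F :: "nat \<Rightarrow> nat \<Rightarrow> 'a::comm_semiring_1"
  shows "(\<Sum>i<2 ^ m. \<Prod>k<m. F k (bitv i k)) = (\<Prod>k<m. F k 0 + F k 1)"
proof (induction m)
  case (Suc m)
  have "(\<Sum>i<2 ^ Suc m. \<Prod>k<Suc m. F k (bitv i k))
      = (\<Sum>i<2 ^ m. (\<Prod>k<m. F k (bitv i k)) * F m 0) + (\<Sum>i<2 ^ m. (\<Prod>k<m. F k (bitv i k)) * F m 1)"
    unfolding power_Suc mult_2 sum_lessThan_add prod.lessThan_Suc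
    by (intro arg_cong2[where f = "(+)"] sum.cong refl)
       (simp_all add: bitv_top_bit cong: prod.cong_simp)
  also have "\<dots> = (\<Prod>k<m. F k 0 + F k 1) * (F m 0 + F m 1)"
    by (simp only: sum_distrib_right[symmetric] Suc.IH distrib_left)
  finally show ?case by simp
qed simp

lemma PC_sum: "PC P0 k 0 + PC P0 k 1 = 1"
  by (simp add: PC_def)

text \<open>Independence of the bits: the expectation of a product of single-bit functions
  factorises.\<close>

lemma symprob_prod_expectation:
  "(\<Sum>i<2 ^ m. symprob m P0 i * (\<Prod>k<m. g k (bitv i k)))
     = (\<Prod>k<m. PC P0 k 0 * g k 0 + PC P0 k 1 * g k 1)"
  unfolding symprob_def prod.distrib[symmetric] by (rule sum_prod_bits)

lemma sum_symprob: "(\<Sum>i<2 ^ m. symprob m P0 i) = 1"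
  using symprob_prod_expectation[of m P0 "\<lambda>_ _. 1"] PC_sum by simp

lemma symprob_bit_expectation:
  assumes "k < m"
  shows "(\<Sum>i<2 ^ m. symprob m P0 i * g (bitv i k)) = PC P0 k 0 * g 0 + PC P0 k 1 * g 1"
proof -
  \<comment> \<open>Pad with the constant function 1 at every other bit; each of these contributes
    expectation 1.\<close>
  have "(\<Sum>i<2 ^ m. symprob m P0 i * g (bitv i k))
      = (\<Sum>i<2 ^ m. symprob m P0 i * (\<Prod>l<m. if l = k then g (bitv i l) else 1))"
    using assms by simp
  also have "\<dots> = (\<Prod>l<m. PC P0 l 0 * (if l = k then g 0 else 1) + PC P0 l 1 * (if l = k then g 1 else 1))"
    by (rule symprob_prod_expectation[where g = "\<lambda>l u. if l = k then g u else 1"])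
  also have "\<dots> = (\<Prod>l<m. if l = k then PC P0 k 0 * g 0 + PC P0 k 1 * g 1 else 1)"
    by (intro prod.cong refl) (auto simp: PC_sum[simplified])
  also have "\<dots> = PC P0 k 0 * g 0 + PC P0 k 1 * g 1" using assms by simp
  finally show ?thesis .
qed

lemma symprob_two_bits:
  assumes "k < m" "l < m" "k \<noteq> l" "u \<in> {0, 1}" "v \<in> {0, 1}"
  shows "(\<Sum>i<2 ^ m. symprob m P0 i * (of_bool (bitv i k = u) * of_bool (bitv i l = v))) = PC P0 k u * PC P0 l v"
proof -
  let ?g = "\<lambda>j b. (if j = k then of_bool (b = u) else 1) * (if j = l then of_bool (b = v) else 1) :: real"
  have "(\<Sum>i<2 ^ m. symprob m P0 i * (of_bool (bitv i k = u) * of_bool (bitv i l = v)))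
      = (\<Sum>i<2 ^ m. symprob m P0 i * (\<Prod>j<m. ?g j (bitv i j)))"
    using assms by (simp add: prod.distrib)
  also have "\<dots> = (\<Prod>j<m. PC P0 j 0 * ?g j 0 + PC P0 j 1 * ?g j 1)"
    by (rule symprob_prod_expectation[where g = ?g])
  also have "\<dots> = (\<Prod>j<m. (if j = k then PC P0 k u else 1) * (if j = l then PC P0 l v else 1))"
    using assms by (intro prod.cong refl) (auto simp: PC_sum[simplified])
  also have "\<dots> = PC P0 k u * PC P0 l v" using assms by (simp add: prod.distrib)
  finally show ?thesis .
qed

text \<open>Pairwise independence for vector-valued functions, obtained by writing \<open>G\<close>
  as a combination of indicators of the two bits.\<close>

lemma symprob_two_bits_expectation:
  fixes G :: "nat \<Rightarrow> nat \<Rightarrow> 'a::real_vector"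
  assumes "k < m" "l < m" "k \<noteq> l"
  shows "(\<Sum>i<2 ^ m. symprob m P0 i *\<^sub>R G (bitv i k) (bitv i l))
    = (\<Sum>u\<in>{0, 1}. \<Sum>v\<in>{0, 1}. (PC P0 k u * PC P0 l v) *\<^sub>R G u v)"
proof -
  have "symprob m P0 i *\<^sub>R G (bitv i k) (bitv i l)
      = (\<Sum>u\<in>{0, 1}. \<Sum>v\<in>{0, 1}. (symprob m P0 i * (of_bool (bitv i k = u) * of_bool (bitv i l = v))) *\<^sub>R G u v)" for i
    using bitv_cases[of i k] bitv_cases[of i l] by auto
  then have "(\<Sum>i<2 ^ m. symprob m P0 i *\<^sub>R G (bitv i k) (bitv i l))
      = (\<Sum>u\<in>{0, 1}. \<Sum>v\<in>{0, 1}. (\<Sum>i<2 ^ m. symprob m P0 i * (of_bool (bitv i k = u) * of_bool (bitv i l = v))) *\<^sub>R G u v)"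
    by (simp add: sum.distrib scaleR_sum_left)
  also have "\<dots> = (\<Sum>u\<in>{0, 1}. \<Sum>v\<in>{0, 1}. (PC P0 k u * PC P0 l v) *\<^sub>R G u v)"
    by (intro sum.cong refl) (simp only: symprob_two_bits[OF assms])
  finally show ?thesis .
qed

definition sym_mean :: "nat \<Rightarrow> (nat \<Rightarrow> real) \<Rightarrow> (nat \<Rightarrow> 'a::real_vector) \<Rightarrow> 'a" where
  "sym_mean m P0 x = (\<Sum>i<2 ^ m. symprob m P0 i *\<^sub>R x i)"

definition bit_mean :: "nat \<Rightarrow> (nat \<Rightarrow> real) \<Rightarrow> (nat \<Rightarrow> 'a::real_vector) \<Rightarrow> nat \<Rightarrow> nat \<Rightarrow> 'a" where
  "bit_mean m P0 x k u = (\<Sum>i\<in>{i. i < 2 ^ m \<and> bitv i k = u}. (symprob m P0 i / PC P0 k u) *\<^sub>R x i)"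

lemma sum_split_bit:
  fixes f :: "nat \<Rightarrow> 'a::comm_monoid_add"
  shows "(\<Sum>i<2 ^ m. f i) = (\<Sum>u\<in>{0, 1}. \<Sum>i\<in>{i. i < 2 ^ m \<and> bitv i k = u}. f i)"
proof -
  have "{..<2 ^ m} = {i. i < 2 ^ m \<and> bitv i k = 0} \<union> {i. i < 2 ^ m \<and> bitv i k = 1}"
    using bitv_cases by auto
  then have "(\<Sum>i<2 ^ m. f i) = (\<Sum>i\<in>{i. i < 2 ^ m \<and> bitv i k = 0} \<union> {i. i < 2 ^ m \<and> bitv i k = 1}. f i)"
    by simp
  also have "\<dots> = (\<Sum>u\<in>{0, 1}. \<Sum>i\<in>{i. i < 2 ^ m \<and> bitv i k = u}. f i)"
    by (subst sum.union_disjoint) auto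
  finally show ?thesis .
qed

section \<open>Projection of the symbol onto sums of single-bit functions\<close>

locale bit_source =
  fixes m :: nat and P0 :: "nat \<Rightarrow> real"
  assumes P0: "\<And>k. k < m \<Longrightarrow> 0 < P0 k \<and> P0 k < 1"
begin

lemma PC_pos: "k < m \<Longrightarrow> 0 < PC P0 k u"
  using P0 by (simp add: PC_def)

lemma symprob_pos: "0 < symprob m P0 i"
  unfolding symprob_def by (intro prod_pos) (simp add: PC_pos)

lemma symprob_weights: "prob_weights {..<2 ^ m} (symprob m P0)"
  by (simp add: prob_weights_def sum_symprob symprob_pos less_imp_le)

lemma bit_weights:
  assumes "k < m" "u \<in> {0, 1}"
  shows "prob_weights {i. i < 2 ^ m \<and> bitv i k = u} (\<lambda>i. symprob m P0 i / PC P0 k u)"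
proof -
  have "(\<Sum>i\<in>{i. i < 2 ^ m \<and> bitv i k = u}. symprob m P0 i) = (\<Sum>i<2 ^ m. symprob m P0 i * of_bool (bitv i k = u))"
    by (intro sum.mono_neutral_cong_left) auto
  also have "\<dots> = PC P0 k u"
    using assms by (subst symprob_bit_expectation[where g = "\<lambda>b. of_bool (b = u)"]) auto
  finally show ?thesis
    using symprob_pos PC_pos[OF assms(1), of u]
    by (auto simp: prob_weights_def sum_divide_distrib[symmetric] intro: less_imp_le)
qed

lemma sum_PC_scaleR_bit_mean:
  assumes "k < m"
  shows "(\<Sum>u\<in>{0, 1}. PC P0 k u *\<^sub>R bit_mean m P0 x k u) = sym_mean m P0 x"
  using PC_pos[OF assms] unfolding sym_mean_def bit_mean_def sum_split_bit[where k = k]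
  by (intro sum.cong refl) (simp add: scaleR_sum_right less_imp_neq[symmetric])

text \<open>The tower property: as \<open>g\<close> depends on bit \<open>k\<close> alone, the
  symbol may be replaced by its conditional mean given that bit.\<close>

lemma sum_symprob_inner_bit:
  fixes x :: "nat \<Rightarrow> 'a::real_inner"
  assumes "k < m"
  shows "(\<Sum>i<2 ^ m. symprob m P0 i * (x i \<bullet> g (bitv i k))) = (\<Sum>u\<in>{0, 1}. PC P0 k u * (bit_mean m P0 x k u \<bullet> g u))"
  using PC_pos[OF assms] unfolding bit_mean_def sum_split_bit[where k = k and m = m]
  by (intro sum.cong refl) (simp add: inner_sum_left sum_distrib_left less_imp_neq[symmetric])

text \<open>The coefficient is the sign \<open>(-1) ^ C\<close> of bit \<open>k\<close> minus its
  mean \<open>PC P0 k 0 - PC P0 k 1\<close>. Every mean-zero function of one bit is a multiple of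
  it, so these are exactly the sums of centred single-bit functions.\<close>

definition centred_affine :: "(nat \<Rightarrow> 'a::real_vector) \<Rightarrow> (nat \<Rightarrow> 'a) \<Rightarrow> bool" where
  "centred_affine x \<beta> \<longleftrightarrow>
     (\<forall>i<2 ^ m. x i = (\<Sum>k<m. ((-1) ^ bitv i k + (PC P0 k 1 - PC P0 k 0)) *\<^sub>R \<beta> k))"

text \<open>The expected energy of the conditional means of the symbol given single bits, which is what the
  first-order expansion of the bit channels retains.\<close>

definition bit_energy :: "(nat \<Rightarrow> 'a::real_inner) \<Rightarrow> real" where
  "bit_energy x = (\<Sum>k<m. (\<Sum>u\<in>{0, 1}. PC P0 k u * (norm (bit_mean m P0 x k u))\<^sup>2) - (norm (sym_mean m P0 x))\<^sup>2)"

context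
  fixes x :: "nat \<Rightarrow> real ^ 'n"
begin

text \<open>The component of the projection that belongs to bit \<open>k\<close>.\<close>

private definition d where "d k u = bit_mean m P0 x k u - sym_mean m P0 x"

private lemma d_centred: "k < m \<Longrightarrow> PC P0 k 0 *\<^sub>R d k 0 + PC P0 k 1 *\<^sub>R d k 1 = 0"
proof -
  assume k: "k < m"
  have "PC P0 k 0 *\<^sub>R d k 0 + PC P0 k 1 *\<^sub>R d k 1
      = (\<Sum>u\<in>{0, 1}. PC P0 k u *\<^sub>R bit_mean m P0 x k u) - (PC P0 k 0 + PC P0 k 1) *\<^sub>R sym_mean m P0 x"
    by (simp add: d_def algebra_simps)
  then show ?thesis by (simp only: sum_PC_scaleR_bit_mean[OF k] PC_sum) simp
qed

text \<open>The variance identity for each conditional mean: by the tower property its cross term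
  with the overall mean is the squared norm of that mean.\<close>

private lemma energy_d: "bit_energy x = (\<Sum>k<m. \<Sum>u\<in>{0, 1}. PC P0 k u * (norm (d k u))\<^sup>2)"
  unfolding bit_energy_def
proof (intro sum.cong refl)
  fix k assume "k \<in> {..<m}"
  then have k: "k < m" by simp
  let ?\<mu> = "sym_mean m P0 x"
  have "(\<Sum>u\<in>{0, 1}. PC P0 k u * (bit_mean m P0 x k u \<bullet> ?\<mu>)) = ?\<mu> \<bullet> ?\<mu>"
    using arg_cong[OF sum_PC_scaleR_bit_mean[OF k, of x], of "\<lambda>v. v \<bullet> ?\<mu>"] by (simp add: inner_add_left)
  moreover have "PC P0 k 0 * (?\<mu> \<bullet> ?\<mu>) + PC P0 k 1 * (?\<mu> \<bullet> ?\<mu>) = ?\<mu> \<bullet> ?\<mu>"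
    by (simp only: distrib_right[symmetric] PC_sum mult_1)
  ultimately show "(\<Sum>u\<in>{0, 1}. PC P0 k u * (norm (bit_mean m P0 x k u))\<^sup>2) - (norm ?\<mu>)\<^sup>2
      = (\<Sum>u\<in>{0, 1}. PC P0 k u * (norm (d k u))\<^sup>2)"
    by (simp add: d_def power2_norm_eq_inner inner_diff_left inner_diff_right inner_commute algebra_simps)
qed

text \<open>Conditioning on bit \<open>k\<close> replaces \<open>x\<close> by \<open>d k\<close>
  plus the overall mean, and the latter drops out because \<open>d k\<close> is centred.\<close>

private lemma inner_d: "(\<Sum>i<2 ^ m. symprob m P0 i * (x i \<bullet> (\<Sum>k<m. d k (bitv i k)))) = bit_energy x"
proof -
  have "(\<Sum>i<2 ^ m. symprob m P0 i * (x i \<bullet> (\<Sum>k<m. d k (bitv i k))))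
      = (\<Sum>k<m. \<Sum>i<2 ^ m. symprob m P0 i * (x i \<bullet> d k (bitv i k)))"
    by (subst sum.swap) (simp add: inner_sum_right sum_distrib_left)
  also have "\<dots> = (\<Sum>k<m. \<Sum>u\<in>{0, 1}. PC P0 k u * (norm (d k u))\<^sup>2)"
  proof (rule sum.cong[OF refl])
    fix k assume "k \<in> {..<m}"
    then have k: "k < m" by simp
    have "PC P0 k 0 * (sym_mean m P0 x \<bullet> d k 0) + PC P0 k 1 * (sym_mean m P0 x \<bullet> d k 1) = 0"
      using arg_cong[OF d_centred[OF k], of "\<lambda>v. sym_mean m P0 x \<bullet> v"] by (simp add: inner_add_right)
    moreover have "bit_mean m P0 x k u = d k u + sym_mean m P0 x" for u by (simp add: d_def)
    ultimately show "(\<Sum>i<2 ^ m. symprob m P0 i * (x i \<bullet> d k (bitv i k))) = (\<Sum>u\<in>{0, 1}. PC P0 k u * (norm (d k u))\<^sup>2)"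
      by (simp add: sum_symprob_inner_bit[OF k] power2_norm_eq_inner inner_add_left algebra_simps)
  qed
  finally show ?thesis by (simp add: energy_d)
qed

text \<open>Pythagoras: centred functions of two different bits are orthogonal by independence, so
  only the diagonal terms survive.\<close>

private lemma norm_d: "(\<Sum>i<2 ^ m. symprob m P0 i * (norm (\<Sum>k<m. d k (bitv i k)))\<^sup>2) = bit_energy x"
proof -
  have "(\<Sum>i<2 ^ m. symprob m P0 i * (norm (\<Sum>k<m. d k (bitv i k)))\<^sup>2)
      = (\<Sum>i<2 ^ m. \<Sum>k<m. \<Sum>l<m. symprob m P0 i * (d k (bitv i k) \<bullet> d l (bitv i l)))"
    by (simp add: power2_norm_eq_inner inner_sum_left inner_sum_right sum_distrib_left)
       (intro sum.cong refl sum.swap)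
  also have "\<dots> = (\<Sum>k<m. \<Sum>l<m. \<Sum>i<2 ^ m. symprob m P0 i * (d k (bitv i k) \<bullet> d l (bitv i l)))"
    by (subst sum.swap) (intro sum.cong refl sum.swap)
  also have "\<dots> = (\<Sum>k<m. \<Sum>l<m. if l = k then \<Sum>u\<in>{0, 1}. PC P0 k u * (norm (d k u))\<^sup>2 else 0)"
  proof (intro sum.cong refl)
    fix k l assume "k \<in> {..<m}" "l \<in> {..<m}"
    then have kl: "k < m" "l < m" by simp_all
    show "(\<Sum>i<2 ^ m. symprob m P0 i * (d k (bitv i k) \<bullet> d l (bitv i l)))
        = (if l = k then \<Sum>u\<in>{0, 1}. PC P0 k u * (norm (d k u))\<^sup>2 else 0)"
    proof (cases "l = k")
      case True
      then show ?thesis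
        using symprob_bit_expectation[OF kl(1), of P0 "\<lambda>b. d k b \<bullet> d k b"]
        by (simp add: power2_norm_eq_inner)
    next
      case False
      then have "(\<Sum>i<2 ^ m. symprob m P0 i * (d k (bitv i k) \<bullet> d l (bitv i l)))
          = (\<Sum>u\<in>{0, 1}. \<Sum>v\<in>{0, 1}. PC P0 k u * PC P0 l v * (d k u \<bullet> d l v))"
        using symprob_two_bits_expectation[OF kl, of P0 "\<lambda>u v. d k u \<bullet> d l v"] by auto
      also have "\<dots> = (PC P0 k 0 *\<^sub>R d k 0 + PC P0 k 1 *\<^sub>R d k 1) \<bullet> (PC P0 l 0 *\<^sub>R d l 0 + PC P0 l 1 *\<^sub>R d l 1)"
        by (simp add: inner_add_left inner_add_right algebra_simps)
      finally show ?thesis using False d_centred[OF kl(1)] by simp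
    qed
  qed
  also have "\<dots> = bit_energy x" by (simp add: energy_d)
  finally show ?thesis .
qed

text \<open>The sum of the centred conditional means is the orthogonal projection of the symbol onto the
  functions that are sums of centred functions of single bits.\<close>

lemma symbol_energy_decomposition:
  "(\<Sum>i<2 ^ m. symprob m P0 i * (norm (x i - (\<Sum>k<m. bit_mean m P0 x k (bitv i k) - sym_mean m P0 x)))\<^sup>2)
     = Esym m P0 x - bit_energy x"
proof -
  have "(norm (x i - (\<Sum>k<m. d k (bitv i k))))\<^sup>2 = (norm (x i))\<^sup>2
      - 2 * (x i \<bullet> (\<Sum>k<m. d k (bitv i k))) + (norm (\<Sum>k<m. d k (bitv i k)))\<^sup>2" for i
    by (simp add: power2_norm_eq_inner inner_diff_left inner_diff_right inner_commute)
  then have "(\<Sum>i<2 ^ m. symprob m P0 i * (norm (x i - (\<Sum>k<m. d k (bitv i k))))\<^sup>2)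
      = Esym m P0 x - 2 * (\<Sum>i<2 ^ m. symprob m P0 i * (x i \<bullet> (\<Sum>k<m. d k (bitv i k))))
        + (\<Sum>i<2 ^ m. symprob m P0 i * (norm (\<Sum>k<m. d k (bitv i k)))\<^sup>2)"
    by (simp only: Esym_def right_diff_distrib distrib_left sum.distrib sum_subtractf sum_distrib_left
        mult.left_commute[of _ 2])
  also have "\<dots> = Esym m P0 x - bit_energy x" by (simp add: inner_d norm_d)
  finally show ?thesis by (simp only: d_def)
qed

text \<open>The expected squared distance to the projection is then zero, and since every symbol has
  positive probability, \<open>x\<close> coincides with its projection.\<close>

lemma bit_energy_eq_Esym_imp_centred_affine:
  assumes "bit_energy x = Esym m P0 x"
  shows "\<exists>\<beta>. centred_affine x \<beta>"
proof
  \<comment> \<open>The half difference is forced: the sign of the bit changes by 2 between its two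
    values.\<close>
  show "centred_affine x (\<lambda>k. (1/2) *\<^sub>R (d k 0 - d k 1))"
    unfolding centred_affine_def
  proof (intro allI impI)
    fix i :: nat assume i: "i < 2 ^ m"
    have "\<forall>i\<in>{..<2 ^ m}. symprob m P0 i * (norm (x i - (\<Sum>k<m. d k (bitv i k))))\<^sup>2 = 0"
      using symbol_energy_decomposition assms symprob_pos
      by (subst sum_nonneg_eq_0_iff[symmetric]) (auto simp: d_def less_imp_le)
    then have "symprob m P0 i * (norm (x i - (\<Sum>k<m. d k (bitv i k))))\<^sup>2 = 0"
      using i by blast
    then have "x i = (\<Sum>k<m. d k (bitv i k))"
      using symprob_pos[of i] by simp
    also have "\<dots> = (\<Sum>k<m. ((-1) ^ bitv i k + (PC P0 k 1 - PC P0 k 0)) *\<^sub>R ((1/2) *\<^sub>R (d k 0 - d k 1)))"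
    proof (intro sum.cong refl)
      fix k assume "k \<in> {..<m}"
      then have c: "PC P0 k 0 *\<^sub>R d k 0 + PC P0 k 1 *\<^sub>R d k 1 = 0" by (intro d_centred) simp
      \<comment> \<open>Centredness expresses \<open>d k 0\<close> and \<open>d k 1\<close> through
        their difference, with factors \<open>PC P0 k 1\<close> and \<open>- PC P0 k 0\<close>.
        These are half the centred signs.\<close>
      have p: "PC P0 k 0 = 1 - PC P0 k 1" using PC_sum[of P0 k] by simp
      have c0: "d k 0 = PC P0 k 1 *\<^sub>R (d k 0 - d k 1)"
        using c unfolding p by (simp add: algebra_simps)
      have c1: "d k 1 = (PC P0 k 1 - 1) *\<^sub>R (d k 0 - d k 1)"
        using c unfolding p by (simp add: algebra_simps)
      show "d k (bitv i k) = ((-1) ^ bitv i k + (PC P0 k 1 - PC P0 k 0)) *\<^sub>R ((1/2) *\<^sub>R (d k 0 - d k 1))"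
        using bitv_cases[of i k]
      proof
        assume "bitv i k = 0"
        then show ?thesis using c0 by (simp add: p)
      next
        assume b: "bitv i k = 1"
        have c: "(- 1 + (PC P0 k 1 - PC P0 k 0)) * (1/2) = PC P0 k 1 - 1" by (simp add: p)
        show ?thesis by (simp only: b power_one_right scaleR_scaleR c) (rule c1)
      qed
    qed
    finally show "x i = (\<Sum>k<m. ((-1) ^ bitv i k + (PC P0 k 1 - PC P0 k 0)) *\<^sub>R ((1/2) *\<^sub>R (d k 0 - d k 1)))" .
  qed
qed

text \<open>The conditional mean given bit \<open>k\<close> is the summand of that bit, since the
  others average to zero by independence. Hence \<open>x\<close> is its own projection, at distance
  zero.\<close>

lemma centred_affine_imp_bit_energy_eq_Esym:
  assumes "centred_affine x \<beta>"
  shows "bit_energy x = Esym m P0 x"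
proof -
  define g where "g k u = ((-1) ^ u + (PC P0 k 1 - PC P0 k 0)) *\<^sub>R \<beta> k" for k u
  have x: "x i = (\<Sum>k<m. g k (bitv i k))" if "i < 2 ^ m" for i
    using assms that by (simp add: centred_affine_def g_def)
  have g0: "PC P0 k 0 *\<^sub>R g k 0 + PC P0 k 1 *\<^sub>R g k 1 = 0" for k
  proof -
    have "PC P0 k 0 *\<^sub>R g k 0 + PC P0 k 1 *\<^sub>R g k 1
        = ((PC P0 k 0 - PC P0 k 1) * (1 - (PC P0 k 0 + PC P0 k 1))) *\<^sub>R \<beta> k"
      by (simp add: g_def algebra_simps)
    then show ?thesis unfolding PC_sum by simp
  qed
  have bm: "bit_mean m P0 x k u = g k u" if "k < m" "u \<in> {0, 1}" for k u
  proof -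
    have "PC P0 k u *\<^sub>R bit_mean m P0 x k u
        = (\<Sum>i\<in>{i. i < 2 ^ m \<and> bitv i k = u}. symprob m P0 i *\<^sub>R x i)"
      using PC_pos[OF that(1), of u] by (simp add: bit_mean_def scaleR_sum_right)
    also have "\<dots> = (\<Sum>i<2 ^ m. symprob m P0 i *\<^sub>R (of_bool (bitv i k = u) *\<^sub>R x i))"
      by (intro sum.mono_neutral_cong_left) auto
    also have "\<dots> = (\<Sum>i<2 ^ m. \<Sum>l<m. symprob m P0 i *\<^sub>R (of_bool (bitv i k = u) *\<^sub>R g l (bitv i l)))"
      by (intro sum.cong refl) (simp add: x scaleR_sum_right)
    also have "\<dots> = (\<Sum>l<m. \<Sum>i<2 ^ m. symprob m P0 i *\<^sub>R (of_bool (bitv i k = u) *\<^sub>R g l (bitv i l)))"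
      by (rule sum.swap)
    also have "\<dots> = (\<Sum>l<m. if l = k then PC P0 k u *\<^sub>R g k u else 0)"
    proof (intro sum.cong refl)
      fix l assume "l \<in> {..<m}"
      then have l: "l < m" by simp
      show "(\<Sum>i<2 ^ m. symprob m P0 i *\<^sub>R (of_bool (bitv i k = u) *\<^sub>R g l (bitv i l)))
          = (if l = k then PC P0 k u *\<^sub>R g k u else 0)"
      proof (cases "l = k")
        case True
        have "(\<Sum>i<2 ^ m. symprob m P0 i *\<^sub>R (of_bool (bitv i k = u) *\<^sub>R g l (bitv i l)))
            = (\<Sum>i<2 ^ m. symprob m P0 i * of_bool (bitv i k = u)) *\<^sub>R g k u"
          unfolding scaleR_sum_left True by (intro sum.cong refl) auto
        also have "(\<Sum>i<2 ^ m. symprob m P0 i * of_bool (bitv i k = u)) = PC P0 k u"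
          using that by (subst symprob_bit_expectation[where g = "\<lambda>b. of_bool (b = u)"]) auto
        finally show ?thesis using True by simp
      next
        case False
        then have "(\<Sum>i<2 ^ m. symprob m P0 i *\<^sub>R (of_bool (bitv i k = u) *\<^sub>R g l (bitv i l)))
            = (\<Sum>b\<in>{0, 1}. \<Sum>v\<in>{0, 1}. (PC P0 k b * PC P0 l v) *\<^sub>R (of_bool (b = u) *\<^sub>R g l v))"
          using that l by (intro symprob_two_bits_expectation[where G = "\<lambda>b v. of_bool (b = u) *\<^sub>R g l v"]) auto
        also have "\<dots> = PC P0 k u *\<^sub>R (PC P0 l 0 *\<^sub>R g l 0 + PC P0 l 1 *\<^sub>R g l 1)"
          using that by (auto simp: scaleR_right_distrib)
        finally show ?thesis using False g0 by simp
      qed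
    qed
    also have "\<dots> = PC P0 k u *\<^sub>R g k u" using that by simp
    finally show ?thesis using PC_pos[OF that(1), of u] by simp
  qed
  \<comment> \<open>The overall mean is recovered by averaging the conditional means of any one bit,
    whence the condition \<open>k < m\<close>.\<close>
  have sm: "sym_mean m P0 x = 0" if "k < m" for k
    using sum_PC_scaleR_bit_mean[OF that, of x] bm[OF that] g0 by simp
  have "Esym m P0 x - bit_energy x = 0"
    unfolding symbol_energy_decomposition[symmetric]
  proof (intro sum.neutral ballI)
    fix i assume "i \<in> {..<(2::nat) ^ m}"
    then have "x i = (\<Sum>k<m. bit_mean m P0 x k (bitv i k) - sym_mean m P0 x)"
      using bitv_cases[of i] by (simp add: x sm bm cong: sum.cong_simp)
    then show "symprob m P0 i * (norm (x i - (\<Sum>k<m. bit_mean m P0 x k (bitv i k) - sym_mean m P0 x)))\<^sup>2 = 0"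
      by simp
  qed
  then show ?thesis by simp
qed

end

end

section \<open>Hadamard inversion and the two coefficient conditions\<close>

definition hsign :: "nat \<Rightarrow> nat \<Rightarrow> nat \<Rightarrow> real" where
  "hsign m i j = (\<Prod>k<m. (-1) ^ (bitv i k * bitv j k))"

lemma hadamard_transform_hsign:
  "hadamard_transform m x i = (1 / 2 ^ m) *\<^sub>R (\<Sum>j<2 ^ m. hsign m i j *\<^sub>R x j)"
  by (simp add: hadamard_transform_def hsign_def)

lemma hsign_commute: "hsign m i j = hsign m j i"
  by (simp add: hsign_def mult.commute)

lemma hsign_zero: "hsign m 0 i = 1"
  by (simp add: hsign_def)

lemma hsign_power_two: "k < m \<Longrightarrow> hsign m (2 ^ k) i = (-1) ^ bitv i k"
proof -
  assume k: "k < m"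
  have "hsign m (2 ^ k) i = (\<Prod>l<m. if l = k then (-1) ^ bitv i k else 1)"
    unfolding hsign_def by (intro prod.cong refl) (auto simp: bitv_power_two)
  then show ?thesis using k by simp
qed

text \<open>The sum factorises over the bit positions, and a position where \<open>i\<close> and
  \<open>l\<close> differ contributes the factor \<open>1 - 1 = 0\<close>.\<close>

lemma hsign_orthogonal:
  assumes "i < 2 ^ m" "l < 2 ^ m"
  shows "(\<Sum>j<2 ^ m. hsign m i j * hsign m l j) = (if i = l then 2 ^ m else 0)"
proof -
  have "(\<Sum>j<2 ^ m. hsign m i j * hsign m l j)
      = (\<Sum>j<2 ^ m. \<Prod>k<m. (\<lambda>b. (-1) ^ (bitv i k * b) * (-1) ^ (bitv l k * b)) (bitv j k))"
    by (simp add: hsign_def prod.distrib)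
  also have "\<dots> = (\<Prod>k<m. 1 + (-1) ^ bitv i k * (-1) ^ bitv l k)"
    by (subst sum_prod_bits[where F = "\<lambda>k b. (-1) ^ (bitv i k * b) * (-1) ^ (bitv l k * b)"]) simp
  also have "\<dots> = (if i = l then 2 ^ m else 0)"
  proof (cases "i = l")
    case True
    then show ?thesis by (simp add: power_add[symmetric])
  next
    case False
    then obtain k where k: "k < m" "bitv i k \<noteq> bitv l k" using bitv_eqI[OF assms] by blast
    then have "1 + (-1) ^ bitv i k * (-1) ^ bitv l k = (0::real)"
      using bitv_cases[of i k] bitv_cases[of l k] by auto
    then show ?thesis using False k by (auto intro!: prod_zero)
  qed
  finally show ?thesis .
qed

text \<open>By orthogonality the symmetric Hadamard matrix is its own inverse up to the factor
  \<open>2 ^ m\<close>.\<close>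

lemma hadamard_inversion:
  fixes x :: "nat \<Rightarrow> real ^ 'n"
  assumes "i < 2 ^ m"
  shows "x i = (\<Sum>j<2 ^ m. hsign m i j *\<^sub>R hadamard_transform m x j)"
proof -
  have "(\<Sum>j<2 ^ m. hsign m i j *\<^sub>R hadamard_transform m x j)
      = (\<Sum>l<2 ^ m. ((1 / 2 ^ m) * (\<Sum>j<2 ^ m. hsign m i j * hsign m l j)) *\<^sub>R x l)"
  proof -
    have "(\<Sum>j<2 ^ m. hsign m i j *\<^sub>R hadamard_transform m x j)
        = (\<Sum>j<2 ^ m. \<Sum>l<2 ^ m. ((1 / 2 ^ m) * (hsign m i j * hsign m l j)) *\<^sub>R x l)"
      unfolding hadamard_transform_hsign scaleR_sum_right scaleR_scaleR
      by (intro sum.cong refl) (simp add: hsign_commute mult_ac)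
    also have "\<dots> = (\<Sum>l<2 ^ m. \<Sum>j<2 ^ m. ((1 / 2 ^ m) * (hsign m i j * hsign m l j)) *\<^sub>R x l)"
      by (rule sum.swap)
    finally show ?thesis unfolding sum_distrib_left scaleR_sum_left .
  qed
  also have "\<dots> = (\<Sum>l<2 ^ m. if l = i then x l else 0)"
    using assms by (intro sum.cong refl) (auto simp: hsign_orthogonal)
  also have "\<dots> = x i" using assms by simp
  finally show ?thesis by simp
qed

text \<open>Row 0 is the constant function and row \<open>2 ^ k\<close> the sign of bit
  \<open>k\<close>. Sums of single-bit functions therefore use only these rows, and centring ties
  the constant coefficient to the others. Inversion gives one direction, orthogonality the
  other.\<close>

lemma (in bit_source) hadamard_conditions_iff_centred_affine:
  fixes x :: "nat \<Rightarrow> real ^ 'n"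
  shows "(hadamard_transform m x 0 =
       (\<Sum>k<m. (PC P0 k 1 - PC P0 k 0) *\<^sub>R hadamard_transform m x (2 ^ k))
     \<and> (\<forall>j<2 ^ m. j \<noteq> 0 \<and> j \<notin> {2 ^ k | k. k < m} \<longrightarrow> hadamard_transform m x j = 0))
    \<longleftrightarrow> (\<exists>\<beta>. centred_affine x \<beta>)" (is "?H \<longleftrightarrow> _")
proof
  assume H: ?H
  let ?X = "hadamard_transform m x"
  have "centred_affine x (\<lambda>k. ?X (2 ^ k))"
    unfolding centred_affine_def
  proof (intro allI impI)
    fix i :: nat assume i: "i < 2 ^ m"
    have "x i = (\<Sum>j<2 ^ m. hsign m i j *\<^sub>R ?X j)" by (rule hadamard_inversion[OF i])
    \<comment> \<open>The second condition removes all other indices.\<close>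
    also have "\<dots> = (\<Sum>j\<in>insert 0 ((\<lambda>k. 2 ^ k) ` {..<m}). hsign m i j *\<^sub>R ?X j)"
      using H by (intro sum.mono_neutral_right) (auto simp: image_iff)
    also have "\<dots> = hsign m i 0 *\<^sub>R ?X 0 + (\<Sum>k<m. hsign m i (2 ^ k) *\<^sub>R ?X (2 ^ k))"
      by (subst sum.insert) (auto simp: sum.reindex inj_on_def)
    also have "\<dots> = (\<Sum>k<m. (PC P0 k 1 - PC P0 k 0) *\<^sub>R ?X (2 ^ k)) + (\<Sum>k<m. (-1) ^ bitv i k *\<^sub>R ?X (2 ^ k))"
      using H by (simp add: hsign_commute[of m i] hsign_zero hsign_power_two)
    also have "\<dots> = (\<Sum>k<m. ((-1) ^ bitv i k + (PC P0 k 1 - PC P0 k 0)) *\<^sub>R ?X (2 ^ k))"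
      by (simp add: sum.distrib[symmetric] scaleR_left_distrib[symmetric] add.commute)
    finally show "x i = (\<Sum>k<m. ((-1) ^ bitv i k + (PC P0 k 1 - PC P0 k 0)) *\<^sub>R ?X (2 ^ k))" .
  qed
  then show "\<exists>\<beta>. centred_affine x \<beta>" by blast
next
  assume "\<exists>\<beta>. centred_affine x \<beta>"
  then obtain \<beta> where \<beta>: "centred_affine x \<beta>" by blast
  let ?A = "\<Sum>k<m. (PC P0 k 1 - PC P0 k 0) *\<^sub>R \<beta> k"
  \<comment> \<open>Coefficients of a combination of the rows 0 and \<open>2 ^ k\<close>, read off
    by orthogonality.\<close>
  have X: "hadamard_transform m x j = (if j = 0 then ?A else 0) + (\<Sum>k<m. if j = 2 ^ k then \<beta> k else 0)"
    if j: "j < 2 ^ m" for j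
  proof -
    have xi: "x i = hsign m 0 i *\<^sub>R ?A + (\<Sum>k<m. hsign m (2 ^ k) i *\<^sub>R \<beta> k)" if "i < 2 ^ m" for i
      using \<beta> that by (simp add: centred_affine_def hsign_zero hsign_power_two scaleR_left_distrib sum.distrib)
    have "(\<Sum>i<2 ^ m. hsign m j i *\<^sub>R x i)
        = (\<Sum>i<2 ^ m. (hsign m j i * hsign m 0 i) *\<^sub>R ?A + (\<Sum>k<m. (hsign m j i * hsign m (2 ^ k) i) *\<^sub>R \<beta> k))"
      by (intro sum.cong refl) (simp only: xi lessThan_iff scaleR_right_distrib scaleR_scaleR scaleR_sum_right[of "hsign m j _" _ "{..<m}"])
    also have "\<dots> = (\<Sum>i<2 ^ m. hsign m j i * hsign m 0 i) *\<^sub>R ?A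
        + (\<Sum>k<m. (\<Sum>i<2 ^ m. hsign m j i * hsign m (2 ^ k) i) *\<^sub>R \<beta> k)"
      unfolding sum.distrib scaleR_sum_left by (subst (2) sum.swap) (rule refl)
    also have "\<dots> = (2 ^ m) *\<^sub>R ((if j = 0 then ?A else 0) + (\<Sum>k<m. if j = 2 ^ k then \<beta> k else 0))"
      unfolding scaleR_right_distrib scaleR_sum_right[of "2 ^ m" "\<lambda>k. if j = 2 ^ k then \<beta> k else 0"]
      using j by (intro arg_cong2[where f = "(+)"] sum.cong refl) (auto simp: hsign_orthogonal)
    finally show ?thesis
      by (simp add: hadamard_transform_hsign)
  qed
  have X2: "hadamard_transform m x (2 ^ k) = \<beta> k" if "k < m" for k
    using that by (subst X) auto
  have X0: "hadamard_transform m x 0 = ?A" by (subst X) auto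
  have "hadamard_transform m x j = 0" if "j < 2 ^ m" "j \<noteq> 0" "j \<notin> {2 ^ k | k. k < m}" for j
    using that by (subst X) (auto intro!: sum.neutral)
  with X0 X2 show ?H by simp
qed

lemma (in bit_source) hadamard_conditions_iff_energy:
  fixes x :: "nat \<Rightarrow> real ^ 'n"
  shows "bit_energy x = Esym m P0 x \<longleftrightarrow> (hadamard_transform m x 0 =
       (\<Sum>k<m. (PC P0 k 1 - PC P0 k 0) *\<^sub>R hadamard_transform m x (2 ^ k))
     \<and> (\<forall>j<2 ^ m. j \<noteq> 0 \<and> j \<notin> {2 ^ k | k. k < m} \<longrightarrow> hadamard_transform m x j = 0))"
  unfolding hadamard_conditions_iff_centred_affine
  using bit_energy_eq_Esym_imp_centred_affine centred_affine_imp_bit_energy_eq_Esym by blast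

section \<open>Bit channels at low signal-to-noise ratio\<close>

lemma fade_scaleR: "fade h (c *\<^sub>R v) = c *\<^sub>R fade h v"
  by (simp add: fade_def vec_eq_iff)

lemma fade_sum: "fade h (sum f A) = (\<Sum>i\<in>A. fade h (f i))"
  by (simp add: fade_def vec_eq_iff sum_distrib_left)

lemma norm_fade: "(norm (fade h v))\<^sup>2 = (\<Sum>j\<in>UNIV. (v $ j)\<^sup>2 * (h $ j)\<^sup>2)"
  unfolding power2_norm_eq_inner inner_vec_def
  by (simp add: fade_def power2_eq_square mult_ac)

lemma fade_measurable [measurable]: "(\<lambda>h. fade h v) \<in> borel_measurable borel"
  unfolding fade_def by (intro borel_measurable_continuous_onI continuous_intros)

text \<open>Needed to average over the fading: joint measurability in \<open>h\<close> and
  \<open>z\<close> passes to the integral over \<open>z\<close>.\<close>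

lemma mix_KL_fade_measurable:
  "(\<lambda>h. mix_KL A w (\<lambda>i. e *\<^sub>R fade h (x i))) \<in> borel_measurable borel"
  unfolding mix_KL_def
proof (rule lborel.borel_measurable_lebesgue_integral)
  have [measurable]: "(\<lambda>p. fade (fst p) (x i)) \<in> borel_measurable (borel \<Otimes>\<^sub>M lborel)" for i
    by (rule measurable_compose[OF measurable_fst fade_measurable])
  have [measurable]: "(\<lambda>p. mix_lr A w (\<lambda>i. e *\<^sub>R fade (fst p) (x i)) (snd p)) \<in> borel_measurable (borel \<Otimes>\<^sub>M lborel)"
    unfolding mix_lr_def by measurable
  show "(\<lambda>(h, z). gauss_pdf 1 z * (mix_lr A w (\<lambda>i. e *\<^sub>R fade h (x i)) z *
      ln (mix_lr A w (\<lambda>i. e *\<^sub>R fade h (x i)) z))) \<in> borel_measurable (borel \<Otimes>\<^sub>M lborel)"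
    unfolding case_prod_beta by measurable
qed

lemma out_pdf_measurable [measurable]: "out_pdf m P0 x s h \<in> borel_measurable borel"
  unfolding out_pdf_def by measurable

lemma bit_pdf_measurable [measurable]: "bit_pdf m P0 x s h k u \<in> borel_measurable borel"
  unfolding bit_pdf_def by measurable

context bit_source
begin

text \<open>The mutual information (in nats) of bit \<open>k\<close> and the output at unit noise variance, written through
  divergences from one fixed Gaussian, each of which has an explicit quadratic expansion.\<close>

definition bit_gap :: "(nat \<Rightarrow> real ^ 'n) \<Rightarrow> nat \<Rightarrow> real" where
  "bit_gap a k = (\<Sum>u\<in>{0, 1}. PC P0 k u *
       mix_KL {i. i < 2 ^ m \<and> bitv i k = u} (\<lambda>i. symprob m P0 i / PC P0 k u) a)
     - mix_KL {..<2 ^ m} (symprob m P0) a"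

lemma mix_lr_split_bit:
  assumes "k < m"
  shows "mix_lr {..<2 ^ m} (symprob m P0) a z = (\<Sum>u\<in>{0, 1}. PC P0 k u *
       mix_lr {i. i < 2 ^ m \<and> bitv i k = u} (\<lambda>i. symprob m P0 i / PC P0 k u) a z)"
  using PC_pos[OF assms] unfolding mix_lr_def sum_split_bit[where k = k and m = m]
  by (intro sum.cong refl) (simp add: sum_distrib_left less_imp_neq[symmetric])

text \<open>The reference Gaussian cancels. As the full mixture is the average of the two
  conditional ones, its divergence splits into their cross terms with the same logarithm.\<close>

lemma bit_gap_eq:
  fixes a :: "nat \<Rightarrow> real ^ 'n"
  assumes k: "k < m"
  defines "B u \<equiv> {i. i < 2 ^ m \<and> bitv i k = u}" and "w u i \<equiv> symprob m P0 i / PC P0 k u"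
  shows "bit_gap a k = (\<Sum>u\<in>{0, 1}. PC P0 k u * (LINT z|lborel. gauss_pdf 1 z *
      (mix_lr (B u) (w u) a z * (ln (mix_lr (B u) (w u) a z) - ln (mix_lr {..<2 ^ m} (symprob m P0) a z)))))"
proof -
  have W: "prob_weights (B u) (w u)" if "u \<in> {0, 1}" for u
    unfolding B_def w_def by (rule bit_weights[OF k that])
  let ?L = "mix_lr {..<2 ^ m} (symprob m P0) a" and ?Lu = "\<lambda>u. mix_lr (B u) (w u) a"
  have sub: "B u \<subseteq> {..<2 ^ m}" for u by (auto simp: B_def)
  have i1: "integrable lborel (\<lambda>z. gauss_pdf 1 z * (?Lu u z * ln (?L z)))" if "u \<in> {0, 1}" for u
    by (rule integrable_gauss_mix_lr_ln[OF symprob_weights W[OF that] sub])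
  have i2: "integrable lborel (\<lambda>z. gauss_pdf 1 z * (?Lu u z * ln (?Lu u z)))" if "u \<in> {0, 1}" for u
    by (rule integrable_gauss_mix_lr_ln[OF W[OF that] W[OF that] order_refl])
  have "mix_KL {..<2 ^ m} (symprob m P0) a
      = (LINT z|lborel. (\<Sum>u\<in>{0, 1}. PC P0 k u * (gauss_pdf 1 z * (?Lu u z * ln (?L z)))))"
    unfolding mix_KL_def
    by (intro Bochner_Integration.integral_cong refl)
       (subst mix_lr_split_bit[OF k], simp add: B_def w_def[abs_def] algebra_simps)
  also have "\<dots> = (\<Sum>u\<in>{0, 1}. PC P0 k u * (LINT z|lborel. gauss_pdf 1 z * (?Lu u z * ln (?L z))))"
    using i1 by (subst Bochner_Integration.integral_sum) auto
  finally have "bit_gap a k = (\<Sum>u\<in>{0, 1}. PC P0 k u *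
      ((LINT z|lborel. gauss_pdf 1 z * (?Lu u z * ln (?Lu u z))) - (LINT z|lborel. gauss_pdf 1 z * (?Lu u z * ln (?L z)))))"
    unfolding bit_gap_def by (simp add: mix_KL_def B_def w_def[abs_def] right_diff_distrib)
  also have "\<dots> = (\<Sum>u\<in>{0, 1}. PC P0 k u * (LINT z|lborel. gauss_pdf 1 z * (?Lu u z * (ln (?Lu u z) - ln (?L z)))))"
    using i1 i2
    by (intro sum.cong refl) (subst Bochner_Integration.integral_diff[symmetric], auto simp: right_diff_distrib)
  finally show ?thesis .
qed

text \<open>Jensen's inequality at each \<open>z\<close>, applied to the two conditional likelihood
  ratios with weights \<open>PC P0 k\<close>.\<close>

lemma bit_gap_nonneg:
  fixes a :: "nat \<Rightarrow> real ^ 'n"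
  assumes k: "k < m"
  shows "0 \<le> bit_gap a k"
proof -
  let ?Lu = "\<lambda>u. mix_lr {i. i < 2 ^ m \<and> bitv i k = u} (\<lambda>i. symprob m P0 i / PC P0 k u) a"
  let ?L = "mix_lr {..<2 ^ m} (symprob m P0) a"
  have w: "prob_weights {0, 1} (PC P0 k)"
    using PC_pos[OF k] PC_sum[of P0 k] by (simp add: prob_weights_def less_imp_le)
  have i: "integrable lborel (\<lambda>z. gauss_pdf 1 z * (?Lu u z * ln (?Lu u z)))" if "u \<in> {0, 1}" for u
    by (rule integrable_gauss_mix_lr_ln[OF bit_weights[OF k that] bit_weights[OF k that] order_refl])
  have "mix_KL {..<2 ^ m} (symprob m P0) a
      \<le> (LINT z|lborel. (\<Sum>u\<in>{0, 1}. PC P0 k u * (gauss_pdf 1 z * (?Lu u z * ln (?Lu u z)))))"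
    unfolding mix_KL_def
  proof (intro integral_mono integrable_gauss_mix_lr_ln[OF symprob_weights symprob_weights order_refl])
    show "integrable lborel (\<lambda>z. \<Sum>u\<in>{0, 1}. PC P0 k u * (gauss_pdf 1 z * (?Lu u z * ln (?Lu u z))))"
      using i by (intro Bochner_Integration.integrable_sum integrable_mult_right)
    fix z :: "real ^ 'n"
    have "?L z * ln (?L z) \<le> (\<Sum>u\<in>{0, 1}. PC P0 k u * (?Lu u z * ln (?Lu u z)))"
      unfolding mix_lr_split_bit[OF k, of a z]
      using mix_lr_pos[OF symprob_weights, of a z] mix_lr_pos[OF bit_weights[OF k], of _ a z]
      unfolding mix_lr_split_bit[OF k, of a z] by (intro log_sum_inequality[OF w])
    then have "gauss_pdf 1 z * (?L z * ln (?L z)) \<le> gauss_pdf 1 z * (\<Sum>u\<in>{0, 1}. PC P0 k u * (?Lu u z * ln (?Lu u z)))"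
      using gauss_pdf_pos[of 1 z] by (intro mult_left_mono) auto
    then show "gauss_pdf 1 z * (?L z * ln (?L z)) \<le> (\<Sum>u\<in>{0, 1}. PC P0 k u * (gauss_pdf 1 z * (?Lu u z * ln (?Lu u z))))"
      by (simp add: algebra_simps)
  qed
  also have "\<dots> = (\<Sum>u\<in>{0, 1}. PC P0 k u * (LINT z|lborel. gauss_pdf 1 z * (?Lu u z * ln (?Lu u z))))"
    using i by (subst Bochner_Integration.integral_sum) auto
  finally show ?thesis by (simp add: bit_gap_def mix_KL_def)
qed

text \<open>This bound is quadratic in the means, hence dominates the fading average with no more than
  second moments of the fading.\<close>

lemma bit_gap_le:
  fixes a :: "nat \<Rightarrow> real ^ 'n"
  assumes k: "k < m"
  shows "bit_gap a k \<le> (\<Sum>i<2 ^ m. symprob m P0 i * ((norm (a i))\<^sup>2 / 2))"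
proof -
  have "bit_gap a k \<le> (\<Sum>u\<in>{0, 1}. PC P0 k u *
       mix_KL {i. i < 2 ^ m \<and> bitv i k = u} (\<lambda>i. symprob m P0 i / PC P0 k u) a)"
    using mix_KL_nonneg[OF symprob_weights, of a] by (simp add: bit_gap_def)
  also have "\<dots> \<le> (\<Sum>u\<in>{0, 1}. PC P0 k u * (\<Sum>i\<in>{i. i < 2 ^ m \<and> bitv i k = u}.
      symprob m P0 i / PC P0 k u * ((norm (a i))\<^sup>2 / 2)))"
    using PC_pos[OF k] by (intro sum_mono mult_left_mono mix_KL_le bit_weights k) (auto intro: less_imp_le)
  also have "\<dots> = (\<Sum>i<2 ^ m. symprob m P0 i * ((norm (a i))\<^sup>2 / 2))"
    using PC_pos[OF k] unfolding sum_split_bit[where k = k and m = m]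
    by (intro sum.cong refl) (simp add: sum_distrib_left less_imp_neq[symmetric])
  finally show ?thesis .
qed

lemma bit_gap_limit:
  fixes a :: "nat \<Rightarrow> real ^ 'n"
  assumes k: "k < m"
  shows "((\<lambda>e. bit_gap (\<lambda>i. e *\<^sub>R a i) k / e\<^sup>2) \<longlongrightarrow>
     ((\<Sum>u\<in>{0, 1}. PC P0 k u * (norm (bit_mean m P0 a k u))\<^sup>2) - (norm (sym_mean m P0 a))\<^sup>2) / 2) (at_right 0)"
proof -
  have "((\<lambda>e. (\<Sum>u\<in>{0, 1}. PC P0 k u * (mix_KL {i. i < 2 ^ m \<and> bitv i k = u}
        (\<lambda>i. symprob m P0 i / PC P0 k u) (\<lambda>i. e *\<^sub>R a i) / e\<^sup>2))
        - mix_KL {..<2 ^ m} (symprob m P0) (\<lambda>i. e *\<^sub>R a i) / e\<^sup>2) \<longlongrightarrow>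
     (\<Sum>u\<in>{0, 1}. PC P0 k u * ((norm (bit_mean m P0 a k u))\<^sup>2 / 2)) - (norm (sym_mean m P0 a))\<^sup>2 / 2) (at_right 0)"
    unfolding bit_mean_def sym_mean_def
    by (intro tendsto_diff tendsto_sum tendsto_mult tendsto_const mix_KL_limit symprob_weights bit_weights k)
  then show ?thesis
    by (simp add: bit_gap_def diff_divide_distrib add_divide_distrib)
qed

text \<open>Substitute \<open>y = sqrt s *\<^sub>R z\<close>. The scale \<open>q\<close> cancels
  within the logarithm, and the Jacobian cancels the one left outside; dividing by
  \<open>ln 2\<close> passes from nats to bits.\<close>

lemma bit_MI_eq:
  fixes x :: "nat \<Rightarrow> real ^ 'n"
  assumes k: "k < m" and s: "0 < s"
  shows "bit_MI m P0 x s h k = bit_gap (\<lambda>i. (1 / sqrt s) *\<^sub>R fade h (x i)) k / ln 2"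
proof -
  define a where "a i = (1 / sqrt s) *\<^sub>R fade h (x i)" for i
  define q where "q = s powr (- real CARD('n) / 2)"
  define B where "B u = {i. i < 2 ^ m \<and> bitv i k = u}" for u
  define w where "w u i = symprob m P0 i / PC P0 k u" for u i
  let ?L = "mix_lr {..<2 ^ m} (symprob m P0) a" and ?Lu = "\<lambda>u. mix_lr (B u) (w u) a"
  have q: "0 < q" using s by (simp add: q_def)
  have qs: "sqrt s ^ CARD('n) * q = 1"
  proof -
    have "sqrt s ^ CARD('n) = s powr (real CARD('n) / 2)"
      using s by (simp add: powr_realpow[symmetric] powr_half_sqrt[symmetric] powr_powr)
    then show ?thesis using s by (simp add: q_def powr_add[symmetric])
  qed
  have g: "gauss_pdf s (sqrt s *\<^sub>R z - fade h (x i)) = q * (gauss_pdf 1 z * exp (a i \<bullet> z - (norm (a i))\<^sup>2 / 2))" for z i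
    unfolding gauss_pdf_scale[OF s] gauss_pdf_shift q_def a_def ..
  have bp: "bit_pdf m P0 x s h k u (sqrt s *\<^sub>R z) = q * (gauss_pdf 1 z * ?Lu u z)" for u z
    unfolding bit_pdf_def g mix_lr_def B_def w_def sum_distrib_left by (intro sum.cong refl) simp
  have op: "out_pdf m P0 x s h (sqrt s *\<^sub>R z) = q * (gauss_pdf 1 z * ?L z)" for z
    unfolding out_pdf_def g mix_lr_def sum_distrib_left by (intro sum.cong refl) simp
  have "(LINT y|lborel. bit_pdf m P0 x s h k u y * log 2 (bit_pdf m P0 x s h k u y / out_pdf m P0 x s h y))
      = (LINT z|lborel. gauss_pdf 1 z * (?Lu u z * (ln (?Lu u z) - ln (?L z)))) / ln 2" if u: "u \<in> {0, 1}" for u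
  proof -
    have "(LINT y|lborel. bit_pdf m P0 x s h k u y * log 2 (bit_pdf m P0 x s h k u y / out_pdf m P0 x s h y))
        = sqrt s ^ CARD('n) * (LINT z|lborel. bit_pdf m P0 x s h k u (sqrt s *\<^sub>R z) *
            log 2 (bit_pdf m P0 x s h k u (sqrt s *\<^sub>R z) / out_pdf m P0 x s h (sqrt s *\<^sub>R z)))"
      using s by (subst integral_lborel_affine[of _ "sqrt s" 0]) simp_all
    also have "\<dots> = sqrt s ^ CARD('n) * (LINT z|lborel. q / ln 2 * (gauss_pdf 1 z * (?Lu u z * (ln (?Lu u z) - ln (?L z)))))"
    proof (rule arg_cong[where f = "\<lambda>v. sqrt s ^ CARD('n) * v"], rule Bochner_Integration.integral_cong[OF refl])
      fix z :: "real ^ 'n"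
      have pos: "0 < ?Lu u z" "0 < ?L z" "0 < gauss_pdf 1 z"
        using mix_lr_pos[OF bit_weights[OF k u]] mix_lr_pos[OF symprob_weights] gauss_pdf_pos[of 1 z]
        by (simp_all add: B_def w_def[abs_def])
      have "q * (gauss_pdf 1 z * ?Lu u z) / (q * (gauss_pdf 1 z * ?L z)) = ?Lu u z / ?L z"
        using q pos by simp
      then show "bit_pdf m P0 x s h k u (sqrt s *\<^sub>R z) *
            log 2 (bit_pdf m P0 x s h k u (sqrt s *\<^sub>R z) / out_pdf m P0 x s h (sqrt s *\<^sub>R z))
          = q / ln 2 * (gauss_pdf 1 z * (?Lu u z * (ln (?Lu u z) - ln (?L z))))"
        unfolding bp op using pos by (simp add: log_def ln_div)
    qed
    also have "\<dots> = (sqrt s ^ CARD('n) * q) * ((LINT z|lborel. gauss_pdf 1 z * (?Lu u z * (ln (?Lu u z) - ln (?L z)))) / ln 2)"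
      by (simp only: integral_mult_right_zero) simp
    finally show ?thesis unfolding qs by simp
  qed
  then have "bit_MI m P0 x s h k = (\<Sum>u\<in>{0, 1}. PC P0 k u *
      ((LINT z|lborel. gauss_pdf 1 z * (?Lu u z * (ln (?Lu u z) - ln (?L z)))) / ln 2))"
    unfolding bit_MI_def by (intro sum.cong refl) simp
  also have "\<dots> = bit_gap a k / ln 2"
    unfolding bit_gap_eq[OF k] B_def w_def[abs_def] by (simp add: sum_divide_distrib add_divide_distrib)
  finally show ?thesis by (simp add: a_def[abs_def])
qed

lemma bit_gap_fade_measurable: "(\<lambda>h. bit_gap (\<lambda>i. e *\<^sub>R fade h (x i)) k) \<in> borel_measurable borel"
  unfolding bit_gap_def
  by (intro borel_measurable_diff borel_measurable_sum borel_measurable_times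
      borel_measurable_const mix_KL_fade_measurable)

section \<open>Fading average and derivative in the SNR\<close>

lemma fading_bit_gap_limit:
  fixes x :: "nat \<Rightarrow> real ^ 'n"
  assumes k: "k < m" and sets: "sets Hd = sets borel"
    and mom: "\<And>v. has_bochner_integral Hd (\<lambda>h. (norm (fade h (v :: real ^ 'n)))\<^sup>2) (E * (norm v)\<^sup>2)"
  shows "((\<lambda>e. LINT h|Hd. bit_gap (\<lambda>i. e *\<^sub>R fade h (x i)) k / e\<^sup>2) \<longlongrightarrow>
    E / 2 * ((\<Sum>u\<in>{0, 1}. PC P0 k u * (norm (bit_mean m P0 x k u))\<^sup>2) - (norm (sym_mean m P0 x))\<^sup>2)) (at_right 0)"
proof -
  let ?f = "\<lambda>h. ((\<Sum>u\<in>{0, 1}. PC P0 k u * (norm (fade h (bit_mean m P0 x k u)))\<^sup>2)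
      - (norm (fade h (sym_mean m P0 x)))\<^sup>2) / 2"
  have f: "has_bochner_integral Hd ?f (((\<Sum>u\<in>{0, 1}. PC P0 k u * (E * (norm (bit_mean m P0 x k u))\<^sup>2))
      - E * (norm (sym_mean m P0 x))\<^sup>2) / 2)"
    by (intro has_bochner_integral_divide_zero has_bochner_integral_diff has_bochner_integral_sum
        has_bochner_integral_mult_right mom)
  have "((\<lambda>e. LINT h|Hd. bit_gap (\<lambda>i. e *\<^sub>R fade h (x i)) k / e\<^sup>2) \<longlongrightarrow> integral\<^sup>L Hd ?f) (at_right 0)"
  proof (rule dominated_convergence_at_right_0)
    show "?f \<in> borel_measurable Hd" using f by (auto simp: has_bochner_integral_iff)
    have "(\<lambda>h. bit_gap (\<lambda>i. e *\<^sub>R fade h (x i)) k) \<in> borel_measurable Hd" for e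
      unfolding measurable_cong_sets[OF sets refl] by (rule bit_gap_fade_measurable)
    then show "(\<lambda>h. bit_gap (\<lambda>i. e *\<^sub>R fade h (x i)) k / e\<^sup>2) \<in> borel_measurable Hd" for e
      by simp
    show "integrable Hd (\<lambda>h. \<Sum>i<2 ^ m. symprob m P0 i * ((norm (fade h (x i)))\<^sup>2 / 2))"
      using mom by (intro Bochner_Integration.integrable_sum integrable_mult_right integrable_divide)
        (auto simp: has_bochner_integral_iff)
    fix h :: "real ^ 'n"
    \<comment> \<open>Fading is linear for fixed \<open>h\<close>, so it commutes with both means
      and the unfaded expansion applies.\<close>
    have "bit_mean m P0 (\<lambda>i. fade h (x i)) k u = fade h (bit_mean m P0 x k u)" for u
      by (simp add: bit_mean_def fade_sum fade_scaleR)
    moreover have "sym_mean m P0 (\<lambda>i. fade h (x i)) = fade h (sym_mean m P0 x)"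
      by (simp add: sym_mean_def fade_sum fade_scaleR)
    ultimately show "((\<lambda>e. bit_gap (\<lambda>i. e *\<^sub>R fade h (x i)) k / e\<^sup>2) \<longlongrightarrow> ?f h) (at_right 0)"
      using bit_gap_limit[OF k, of "\<lambda>i. fade h (x i)"] by (simp only:)
    fix e :: real assume "0 < e"
    moreover have "bit_gap (\<lambda>i. e *\<^sub>R fade h (x i)) k
        \<le> e\<^sup>2 * (\<Sum>i<2 ^ m. symprob m P0 i * ((norm (fade h (x i)))\<^sup>2 / 2))"
      using bit_gap_le[OF k, of "\<lambda>i. e *\<^sub>R fade h (x i)"]
      by (simp add: power_mult_distrib sum_distrib_left mult_ac)
    ultimately show "\<bar>bit_gap (\<lambda>i. e *\<^sub>R fade h (x i)) k / e\<^sup>2\<bar>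
        \<le> (\<Sum>i<2 ^ m. symprob m P0 i * ((norm (fade h (x i)))\<^sup>2 / 2))"
      using bit_gap_nonneg[OF k, of "\<lambda>i. e *\<^sub>R fade h (x i)"] by (simp add: pos_divide_le_eq mult.commute)
  qed
  moreover have "integral\<^sup>L Hd ?f = E / 2 * ((\<Sum>u\<in>{0, 1}. PC P0 k u * (norm (bit_mean m P0 x k u))\<^sup>2) - (norm (sym_mean m P0 x))\<^sup>2)"
    using f by (simp add: has_bochner_integral_iff algebra_simps)
  ultimately show ?thesis by simp
qed

lemma bicm_gmi_derivative:
  fixes x :: "nat \<Rightarrow> real ^ 'n"
  assumes sets: "sets Hd = sets borel"
    and mom: "\<And>v. has_bochner_integral Hd (\<lambda>h. (norm (fade h (v :: real ^ 'n)))\<^sup>2) (EH2 pH * (norm v)\<^sup>2)"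
    and E: "0 < EH2 pH" "0 < Esym m P0 x"
  shows "(bicm_gmi m P0 x Hd pH has_real_derivative bit_energy x / Esym m P0 x * log 2 (exp 1)) (at_right 0)"
proof -
  define c where "c = EH2 pH * Esym m P0 x"
  have c: "0 < c" using E by (simp add: c_def)
  \<comment> \<open>The inverse noise standard deviation at SNR \<open>t\<close>. Its square is
    linear in \<open>t\<close>, which turns the quadratic expansion in \<open>e\<close> into a first
    derivative in the SNR.\<close>
  define e where "e t = 1 / sqrt (c / t / 2)" for t
  have e_pos: "0 < e t" and e_sq: "(e t)\<^sup>2 = 2 * t / c" if "0 < t" for t
    using that c by (simp_all add: e_def power_divide)
  define F where "F s = (\<Sum>k<m. LINT h|Hd. bit_gap (\<lambda>i. s *\<^sub>R fade h (x i)) k / s\<^sup>2)" for s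
  have "(F \<longlongrightarrow> EH2 pH / 2 * bit_energy x) (at_right 0)"
    unfolding F_def bit_energy_def sum_distrib_left
    by (intro tendsto_sum fading_bit_gap_limit sets mom) auto
  moreover have "filterlim e (at_right 0) (at_right 0)"
  proof -
    have "((\<lambda>t. sqrt (2 * t / c)) \<longlongrightarrow> sqrt (2 * 0 / c)) (at_right 0)"
      using c by (intro tendsto_intros) auto
    moreover have "e = (\<lambda>t. sqrt (2 * t / c))"
      by (simp add: fun_eq_iff e_def real_sqrt_divide real_sqrt_mult)
    ultimately have "(e \<longlongrightarrow> 0) (at_right 0)" by simp
    moreover have "\<forall>\<^sub>F t in at_right 0. e t \<in> {0<..} \<and> e t \<noteq> 0"
      unfolding eventually_at_filter using e_pos by (intro always_eventually) fastforce
    ultimately show ?thesis by (simp only: filterlim_at)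
  qed
  ultimately have "((\<lambda>t. F (e t)) \<longlongrightarrow> EH2 pH / 2 * bit_energy x) (at_right 0)"
    by (rule filterlim_compose)
  then have "((\<lambda>t. F (e t) * (2 / (c * ln 2))) \<longlongrightarrow> EH2 pH / 2 * bit_energy x * (2 / (c * ln 2))) (at_right 0)"
    by (intro tendsto_mult tendsto_const)
  \<comment> \<open>The fading moment in \<open>c\<close> cancels the one from the limit, and
    \<open>1 / ln 2\<close> is \<open>log 2 (exp 1)\<close>.\<close>
  moreover have "EH2 pH / 2 * bit_energy x * (2 / (c * ln 2)) = bit_energy x / Esym m P0 x * log 2 (exp 1)"
    using E by (simp add: c_def log_def)
  moreover have "F (e t) * (2 / (c * ln 2)) = (bicm_gmi m P0 x Hd pH t - bicm_gmi m P0 x Hd pH 0) / (t - 0)"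
    if t: "0 < t" for t
  proof -
    have "bicm_gmi m P0 x Hd pH t = (\<Sum>k<m. LINT h|Hd. bit_MI m P0 x (c / t / 2) h k)"
      using t by (simp add: bicm_gmi_def c_def Let_def)
    also have "\<dots> = (\<Sum>k<m. (LINT h|Hd. bit_gap (\<lambda>i. e t *\<^sub>R fade h (x i)) k) / ln 2)"
      using c t by (intro sum.cong refl) (simp add: bit_MI_eq e_def)
    also have "\<dots> = F (e t) * (e t)\<^sup>2 / ln 2"
      using e_pos[OF t] by (simp add: F_def sum_divide_distrib sum_distrib_right)
    \<comment> \<open>The rate is set to 0 at SNR 0, so the difference quotient is the rate divided
      by \<open>t\<close>.\<close>
    finally show ?thesis
      using t c by (simp add: e_sq bicm_gmi_def[of _ _ _ _ _ 0])
  qed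
  ultimately show ?thesis
    unfolding has_field_derivative_iff
    by (auto simp: eventually_at_filter elim!: Lim_transform_eventually)
qed

end

text \<open>The squared norm has no mixed coordinate terms, so the common marginal law determines
  its expectation.\<close>

lemma fading_second_moment:
  fixes Hd :: "(real ^ 'n) measure"
  assumes sets: "sets Hd = sets borel"
    and marg: "\<forall>j. distr Hd lborel (\<lambda>h. h $ j) = density lborel pH"
    and pH: "pH \<in> borel_measurable lborel" "\<forall>t. 0 \<le> pH t" "integrable lborel (\<lambda>t. t\<^sup>2 * pH t)"
  shows "has_bochner_integral Hd (\<lambda>h. (norm (fade h v))\<^sup>2) (EH2 pH * (norm v)\<^sup>2)"
proof -
  have meas: "(\<lambda>h. h $ j) \<in> measurable Hd lborel" for j
    unfolding measurable_cong_sets[OF sets sets_lborel]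
    by (intro borel_measurable_continuous_onI continuous_intros)
  have "has_bochner_integral (density lborel pH) (\<lambda>t. t\<^sup>2) (EH2 pH)"
    using pH by (intro has_bochner_integral_density) (auto simp: has_bochner_integral_iff EH2_def mult.commute)
  then have "has_bochner_integral Hd (\<lambda>h. (h $ j)\<^sup>2) (EH2 pH)" for j
    unfolding marg[rule_format, of j, symmetric]
    by (simp add: has_bochner_integral_iff integrable_distr_eq[OF meas] integral_distr[OF meas])
  then have "has_bochner_integral Hd (\<lambda>h. \<Sum>j\<in>UNIV. (v $ j)\<^sup>2 * (h $ j)\<^sup>2) (\<Sum>j\<in>UNIV. (v $ j)\<^sup>2 * EH2 pH)"
    by (intro has_bochner_integral_sum has_bochner_integral_mult_right)
  moreover have "(\<Sum>j\<in>UNIV. (v $ j)\<^sup>2 * EH2 pH) = EH2 pH * (norm v)\<^sup>2"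
    unfolding power2_norm_eq_inner inner_vec_def by (simp add: sum_distrib_left power2_eq_square mult.commute)
  ultimately show ?thesis unfolding norm_fade by simp
qed

theorem theorem8:
  fixes m :: nat and P0 :: "nat \<Rightarrow> real" and x :: "nat \<Rightarrow> real ^ 'n"
    and Hd :: "(real ^ 'n) measure" and pH :: "real \<Rightarrow> real"
  assumes "m \<ge> 1"
    and "\<forall>k<m. 0 < P0 k \<and> P0 k < 1"
    and "prob_space Hd" and "sets Hd = sets borel"
    and "\<forall>j. distr Hd lborel (\<lambda>h. h $ j) = density lborel pH"
    and "pH \<in> borel_measurable lborel" and "\<forall>t. 0 \<le> pH t"
    and "integrable lborel (\<lambda>t. t\<^sup>2 * pH t)" and "EH2 pH > 0"
    and "Esym m P0 x > 0"
  shows "first_order_optimal m P0 x Hd pH \<longleftrightarrow>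
    (hadamard_transform m x 0 =
       (\<Sum>k<m. (PC P0 k 1 - PC P0 k 0) *\<^sub>R hadamard_transform m x (2 ^ k))
     \<and> (\<forall>j<2 ^ m. j \<noteq> 0 \<and> j \<notin> {2 ^ k | k. k < m} \<longrightarrow> hadamard_transform m x j = 0))"
proof -
  interpret bit_source m P0 using assms(2) by unfold_locales auto
  let ?\<alpha> = "bit_energy x / Esym m P0 x * log 2 (exp 1)"
  have D: "(bicm_gmi m P0 x Hd pH has_real_derivative ?\<alpha>) (at_right 0)"
    by (intro bicm_gmi_derivative fading_second_moment assms)
  have "first_order_optimal m P0 x Hd pH \<longleftrightarrow> ?\<alpha> = log 2 (exp 1)"
  proof
    assume "first_order_optimal m P0 x Hd pH"
    then have "(bicm_gmi m P0 x Hd pH has_real_derivative log 2 (exp 1)) (at_right 0)"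
      by (simp add: first_order_optimal_def)
    \<comment> \<open>A one-sided derivative is unique because 0 is a limit point of the positive
      reals.\<close>
    with D show "?\<alpha> = log 2 (exp 1)"
      unfolding has_field_derivative_iff by (rule tendsto_unique[OF trivial_limit_at_right_real])
  qed (use D in \<open>simp add: first_order_optimal_def\<close>)
  also have "\<dots> \<longleftrightarrow> bit_energy x = Esym m P0 x"
    \<comment> \<open>Both the symbol energy and \<open>log 2 (exp 1)\<close> are nonzero and may be
      cancelled.\<close>
    using assms(10) by (auto simp: log_def field_simps)
  also note hadamard_conditions_iff_energy
  finally show ?thesis .
qed

end
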